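(* Let a consistent class of data with base $X$, locally compact space $Y$, Radon measure $\mu$ on $Y$, family $\{\mathfrak E_x\}_{x\in X}$ with fundamental sets of seminorms $\{\nu^x_{j_x}:j_x\in J_x\}$, topologies $\{\tau_x\}_{x\in X}$, space $\langle\mathcal H,\mathfrak T\rangle$ and linear space $\mathcal A$ be given, and let $\mathfrak G$ and $\Psi_Y^{\mathcal H}$ be the associated objects (see context). For each $x\in X$ let $\mathcal S(x)=\{B^x_{l_x}:l_x\in L_x\}$ be a set of bounded subsets of $\mathfrak E_x$, and let $\mathcal D$ be a set, such that $$N(x):=\bigcup_{l_x\in L_x}B^x_{l_x}\ \text{is total in }\mathfrak E_x\ \ \forall x\in X,\qquad \mathcal D\subseteq\mathcal H\cap\prod_{x\in X}N(x).$$ Assume that for all $x\in X$ the topology $\tau_x$ is generated by the seminorms $p^x_{(l_x,j_x)}(f)=\sup_{w\in B^x_{l_x}}\nu^x_{j_x}(f(w))$, $(l_x,j_x)\in L_x\times J_x$, i.e. $\langle\mathcal L(\mathfrak E_x),\tau_x\rangle=\mathcal L_{\mathcal S(x)}(\mathfrak E_x)$. Then: (1) for all $x\in X$ and $v_x\in\Pr_x(\mathcal D)$ the evaluation $f\mapsto f(v_x)$ is continuous from $\langle\mathcal L(\mathfrak E_x),\tau_x\rangle$ to $\mathfrak E_x$; (2) for all $\overline F\in\mathfrak L_1(Y,\mathfrak G,\mu)$, $x\in X$ and $v\in\mathcal D$ $$\int\Pr_x(\Psi_Y^{\mathcal H}(\overline F))(s)(v(x))\,d\mu(s)=\Bigl(\Bigl(\int\overline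 F(s)\,d\mu(s)\Bigr)(v)\Bigr)(x)$$ (the left integral being in $\mathfrak E_x$, the right one in $\mathfrak G$), and $\mathfrak G$ is a $\mathsf U$-space with respect to $\{\mathcal L_{\mathcal S(x)}(\mathfrak E_x)\}_{x\in X}$, $\mathfrak T$ and $\mathcal D$.
   Context: Hlcs means Hausdorff locally convex space (over $\mathbb C$); $\mathcal L(E)$ denotes the continuous, $End(E)$ all linear endomorphisms of $E$. For $Y$ locally compact, $\mu$ a Radon measure, $E$ a Hlcs, $\mathfrak L_1(Y,E,\mu)$ is the space of scalarly essentially $\mu$-integrable maps $Y\to E$ whose (weak) integral belongs to $E$ (Bourbaki). For a family of vector spaces $\{Z_x\}_{x\in X}$, $\Pr_x:\prod_yZ_y\to Z_x$ is the projection and $\imath_x:Z_x\to\prod_yZ_y$ the canonical injection (zero in all other coordinates). Consistent class of data: a set $X$, a locally compact space $Y$ with a Radon measure $\mu$, Hlcs $\mathfrak E_x$ ($x\in X$) with fundamental sets of seminorms, topologies $\tau_x$ making $\langle\mathcal L(\mathfrak E_x),\tau_x\rangle$ a Hlcs (with fundamental sets of seminorms), and a Hlcs $\langle\mathcal H,\mathfrak T\rangle$ such that: $\mathcal H$ is a linear subspace of $\prod_x\mathfrak E_x$; $\imath_x(\mathfrak E_x)\subset\mathcal H$ for all $x$; $\Pr_x:\langle\mathcal H,\mathfrak T\rangle\to\mathfrak E_x$ and $\imath_x:\mathfrak E_x\to\langle\mathcal H,\mathfrak T\rangle$ are continuous for all $x$; and $\mathcal A\subseteq\prod_x\mathcal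 L(\mathfrak E_x)$ is a linear subspace with $\theta(u)|_{\mathcal H}\in\mathcal L(\langle\mathcal H,\mathfrak T\rangle)$ for all $u\in\mathcal A$ and $\imath_x(\mathcal L(\mathfrak E_x))\subseteq\mathcal A$ for all $x$. Here $\theta:\prod_xEnd(\mathfrak E_x)\to End(\prod_x\mathfrak E_x)$ is given by $\Pr_x\circ\theta(u)=\Pr_x(u)\circ\Pr_x$. $\mathfrak G$ is the vector space $G=\{\theta(u)|_{\mathcal H}:u\in\mathcal A\}$ with the finest locally convex topology making all maps $h_x:\langle\mathcal L(\mathfrak E_x),\tau_x\rangle\to G$, $h_x(f)=(\imath_x\circ f\circ\Pr_x)|_{\mathcal H}$, continuous. For $T$ locally compact, $\Psi_T^{\mathcal H}:End(\mathcal H)^T\to\prod_xEnd(\mathfrak E_x)^T$, $\Psi_T^{\mathcal H}(\overline F)(x)(s)=\Pr_x\circ\overline F(s)\circ\imath_x$. $\mathsf U$-space. A Hlcs $\mathfrak G'$ is a $\mathsf U$-space with respect to $\{\langle\mathcal L(\mathfrak E_x),\tau_x\rangle\}_{x}$, $\mathfrak T$ and $D$ if $\mathfrak G'\subset\mathcal L(\langle\mathcal H,\mathfrak T\rangle)$ as vector spaces, $D\subseteq\mathcal H$, and for every locally compact space $T$ there is a linear map $\Psi_T:End(\mathcal H)^T\to\prod_xEnd(\mathfrak E_x)^T$ such that for every Radon measure $\nu$ on $T$: $\Psi_T(\mathfrak L_1(T,\mathfrak G',\nu))\subseteq\prod_x\mathfrak L_1(T,\langle\mathcal L(\mathfrak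 E_x),\tau_x\rangle,\nu)$ and $\bigl(\int\Psi_T(\overline F)(x)(s)\,d\nu(s)\bigr)(v(x))=\bigl((\int\overline F(s)\,d\nu(s))(v)\bigr)(x)$ for all $\overline F\in\mathfrak L_1(T,\mathfrak G',\nu)$, $v\in D$, $x\in X$. *)

theory Defs
  imports "HOL-Analysis.Analysis" "HOL-Library.Function_Algebras"
begin

section \<open>Complex vector spaces, products and linear maps\<close>

text \<open>
  A complex vector space is a linear subspace \<open>V\<close> of a type of class \<open>cvec\<close>. This is no
  restriction on families: choosing bases, a family of complex vector spaces \<open>(Z x)\<close> with elements
  in \<open>'a\<close> embeds into \<open>'x \<times> 'a \<Rightarrow> complex\<close>. Maps that are only defined on a set \<open>S\<close> are
  represented by functions vanishing outside \<open>S\<close>, so that products and spaces of maps are again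
  linear subspaces of function types, with pointwise operations.
\<close>

class cvec = ab_group_add +
  fixes scaleC :: "complex \<Rightarrow> 'a \<Rightarrow> 'a" (infixr \<open>*\<^sub>C\<close> 75)
  assumes scaleC_add_right: "c *\<^sub>C (a + b) = c *\<^sub>C a + c *\<^sub>C b"
    and scaleC_add_left: "(c + d) *\<^sub>C a = c *\<^sub>C a + d *\<^sub>C a"
    and scaleC_scaleC: "c *\<^sub>C d *\<^sub>C a = (c * d) *\<^sub>C a"
    and scaleC_one: "1 *\<^sub>C a = a"

instantiation complex :: cvec
begin
definition scaleC_complex :: "complex \<Rightarrow> complex \<Rightarrow> complex" where
  "scaleC_complex c a = c * a"
instance
  by standard (simp_all add: scaleC_complex_def algebra_simps)
end

instantiation "fun" :: (type, cvec) cvec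
begin
definition scaleC_fun :: "complex \<Rightarrow> ('a \<Rightarrow> 'b) \<Rightarrow> 'a \<Rightarrow> 'b" where
  "scaleC_fun c f = (\<lambda>x. c *\<^sub>C f x)"
instance
  by standard
    (simp_all add: scaleC_fun_def fun_eq_iff scaleC_add_right scaleC_add_left scaleC_scaleC
      scaleC_one)
end

global_interpretation cvs: vector_space "scaleC :: complex \<Rightarrow> 'a \<Rightarrow> 'a::cvec"
  by standard (simp_all add: scaleC_add_right scaleC_add_left scaleC_scaleC scaleC_one)

text \<open>The product \<open>\<Prod>x\<in>X. Z x\<close>; for constant \<open>Z\<close> it is the set of all maps from \<open>X\<close> to \<open>Z\<close>.\<close>
definition prod_sp :: "'x set \<Rightarrow> ('x \<Rightarrow> 'a::zero set) \<Rightarrow> ('x \<Rightarrow> 'a) set" where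
  "prod_sp X Z = {z. (\<forall>x\<in>X. z x \<in> Z x) \<and> (\<forall>x. x \<notin> X \<longrightarrow> z x = 0)}"

definition iota :: "'x \<Rightarrow> 'a::zero \<Rightarrow> 'x \<Rightarrow> 'a" where
  "iota x z = (\<lambda>y. if y = x then z else 0)"

definition restr :: "'a set \<Rightarrow> ('a \<Rightarrow> 'b::zero) \<Rightarrow> 'a \<Rightarrow> 'b" where
  "restr S f = (\<lambda>a. if a \<in> S then f a else 0)"

definition lin_maps :: "'a::cvec set \<Rightarrow> 'b::cvec set \<Rightarrow> ('a \<Rightarrow> 'b) set" where
  "lin_maps V W = {f. (\<forall>a\<in>V. f a \<in> W) \<and> (\<forall>a. a \<notin> V \<longrightarrow> f a = 0)
     \<and> (\<forall>a\<in>V. \<forall>b\<in>V. f (a + b) = f a + f b) \<and> (\<forall>c. \<forall>a\<in>V. f (c *\<^sub>C a) = c *\<^sub>C f a)}"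

definition End_sp :: "'a::cvec set \<Rightarrow> ('a \<Rightarrow> 'a) set" where
  "End_sp V = lin_maps V V"

section \<open>Hausdorff locally convex spaces\<close>

definition seminorm_on :: "'a::cvec set \<Rightarrow> ('a \<Rightarrow> real) \<Rightarrow> bool" where
  "seminorm_on V p \<longleftrightarrow> (\<forall>a\<in>V. 0 \<le> p a) \<and> (\<forall>a\<in>V. \<forall>b\<in>V. p (a + b) \<le> p a + p b)
     \<and> (\<forall>c. \<forall>a\<in>V. p (c *\<^sub>C a) = cmod c * p a)"

definition seminorm_topology :: "'a::cvec set \<Rightarrow> ('a \<Rightarrow> real) set \<Rightarrow> 'a topology" where
  "seminorm_topology V P = topology_generated_by
     (insert V {{b \<in> V. p (b - a) < e} | p a e. p \<in> P \<and> a \<in> V \<and> 0 < e})"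

definition locally_convex :: "'a::cvec set \<Rightarrow> 'a topology \<Rightarrow> bool" where
  "locally_convex V T \<longleftrightarrow> cvs.subspace V
     \<and> (\<exists>P. (\<forall>p\<in>P. seminorm_on V p) \<and> T = seminorm_topology V P)"

definition hlcs :: "'a::cvec set \<Rightarrow> 'a topology \<Rightarrow> bool" where
  "hlcs V T \<longleftrightarrow> locally_convex V T \<and> Hausdorff_space T"

definition cont_End :: "'a::cvec set \<Rightarrow> 'a topology \<Rightarrow> ('a \<Rightarrow> 'a) set" where
  "cont_End V T = {f \<in> End_sp V. continuous_map T T f}"

definition dual_sp :: "'a::cvec set \<Rightarrow> 'a topology \<Rightarrow> ('a \<Rightarrow> complex) set" where
  "dual_sp V T = {\<phi> \<in> lin_maps V UNIV. continuous_map T euclidean \<phi>}"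

definition vn_bounded :: "'a::cvec set \<Rightarrow> 'a topology \<Rightarrow> 'a set \<Rightarrow> bool" where
  "vn_bounded V T B \<longleftrightarrow> B \<subseteq> V \<and>
     (\<forall>U. openin T U \<and> 0 \<in> U \<longrightarrow> (\<exists>r>0. \<forall>c. r \<le> cmod c \<longrightarrow> B \<subseteq> (\<lambda>a. c *\<^sub>C a) ` U))"

definition total_in :: "'a::cvec set \<Rightarrow> 'a topology \<Rightarrow> 'a set \<Rightarrow> bool" where
  "total_in V T N \<longleftrightarrow> N \<subseteq> V \<and> T closure_of (cvs.span N) = V"

text \<open>Inserting \<open>0\<close> gives the supremum over an empty \<open>B\<close> its usual value \<open>0\<close>.\<close>
definition sup_seminorm :: "'a set \<Rightarrow> ('a \<Rightarrow> real) \<Rightarrow> ('a \<Rightarrow> 'a) \<Rightarrow> real" where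
  "sup_seminorm B p f = Sup (insert 0 ((\<lambda>w. p (f w)) ` B))"

text \<open>The topology of uniform convergence on the sets \<open>B l\<close>, \<open>l \<in> L\<close>, where \<open>p j\<close>, \<open>j \<in> J\<close>, is
  a fundamental set of seminorms of \<open>V\<close>.\<close>
definition S_topology ::
  "'a::cvec set \<Rightarrow> 'a topology \<Rightarrow> 'j set \<Rightarrow> ('j \<Rightarrow> 'a \<Rightarrow> real) \<Rightarrow> 'l set \<Rightarrow> ('l \<Rightarrow> 'a set)
     \<Rightarrow> ('a \<Rightarrow> 'a) topology" where
  "S_topology V T J p L B =
     seminorm_topology (cont_End V T) {sup_seminorm (B l) (p j) | l j. l \<in> L \<and> j \<in> J}"

definition is_finest_lc ::
  "'b::cvec set \<Rightarrow> 'x set \<Rightarrow> ('x \<Rightarrow> 'a topology) \<Rightarrow> ('x \<Rightarrow> 'a \<Rightarrow> 'b) \<Rightarrow> 'b topology \<Rightarrow> bool" where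
  "is_finest_lc V X S h T \<longleftrightarrow>
     locally_convex V T \<and> (\<forall>x\<in>X. continuous_map (S x) T (h x)) \<and>
     (\<forall>T'. locally_convex V T' \<and> (\<forall>x\<in>X. continuous_map (S x) T' (h x))
        \<longrightarrow> (\<forall>U. openin T' U \<longrightarrow> openin T U))"

definition finest_lc_topology ::
  "'b::cvec set \<Rightarrow> 'x set \<Rightarrow> ('x \<Rightarrow> 'a topology) \<Rightarrow> ('x \<Rightarrow> 'a \<Rightarrow> 'b) \<Rightarrow> 'b topology" where
  "finest_lc_topology V X S h = (THE T. is_finest_lc V X S h T)"

section \<open>Radon measures and essential integrals, after Bourbaki\<close>

definition Cc :: "'t topology \<Rightarrow> ('t \<Rightarrow> complex) set" where
  "Cc T = {f. continuous_map T euclidean f \<and> (\<forall>t. t \<notin> topspace T \<longrightarrow> f t = 0)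
     \<and> compactin T (T closure_of {t \<in> topspace T. f t \<noteq> 0})}"

text \<open>A (complex) Radon measure is a linear form on \<open>Cc T\<close> that is continuous on the functions
  supported in \<open>K\<close>, for every compact \<open>K\<close>. Its values outside \<open>Cc T\<close> are irrelevant.\<close>
definition radon_measure :: "'t topology \<Rightarrow> (('t \<Rightarrow> complex) \<Rightarrow> complex) \<Rightarrow> bool" where
  "radon_measure T \<mu> \<longleftrightarrow>
     (\<forall>f\<in>Cc T. \<forall>g\<in>Cc T. \<mu> (f + g) = \<mu> f + \<mu> g) \<and>
     (\<forall>c. \<forall>f\<in>Cc T. \<mu> (c *\<^sub>C f) = c * \<mu> f) \<and>
     (\<forall>K. compactin T K \<longrightarrow> (\<exists>M. \<forall>f\<in>Cc T. \<forall>b. {t \<in> topspace T. f t \<noteq> 0} \<subseteq> K \<and>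
        (\<forall>t\<in>topspace T. cmod (f t) \<le> b) \<and> 0 \<le> b \<longrightarrow> cmod (\<mu> f) \<le> M * b))"

text \<open>The absolute value \<open>|\<mu>|\<close> on nonnegative continuous functions with compact support.\<close>
definition abs_measure ::
  "'t topology \<Rightarrow> (('t \<Rightarrow> complex) \<Rightarrow> complex) \<Rightarrow> ('t \<Rightarrow> real) \<Rightarrow> ennreal" where
  "abs_measure T \<mu> k =
     (SUP g\<in>{g \<in> Cc T. \<forall>t\<in>topspace T. cmod (g t) \<le> k t}. ennreal (cmod (\<mu> g)))"

definition lower_semicont :: "'t topology \<Rightarrow> ('t \<Rightarrow> ennreal) \<Rightarrow> bool" where
  "lower_semicont T h \<longleftrightarrow> (\<forall>a. openin T {t \<in> topspace T. a < h t})"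

definition upper_integral_lsc ::
  "'t topology \<Rightarrow> (('t \<Rightarrow> complex) \<Rightarrow> complex) \<Rightarrow> ('t \<Rightarrow> ennreal) \<Rightarrow> ennreal" where
  "upper_integral_lsc T \<mu> h =
     (SUP k\<in>{k. (\<lambda>t. complex_of_real (k t)) \<in> Cc T \<and>
                (\<forall>t\<in>topspace T. 0 \<le> k t \<and> ennreal (k t) \<le> h t)}. abs_measure T \<mu> k)"

text \<open>The upper integral \<open>|\<mu>|\<^sup>*(f)\<close>.\<close>
definition upper_integral ::
  "'t topology \<Rightarrow> (('t \<Rightarrow> complex) \<Rightarrow> complex) \<Rightarrow> ('t \<Rightarrow> ennreal) \<Rightarrow> ennreal" where
  "upper_integral T \<mu> f =
     (INF h\<in>{h. lower_semicont T h \<and> (\<forall>t\<in>topspace T. f t \<le> h t)}. upper_integral_lsc T \<mu> h)"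

definition loc_negligible ::
  "'t topology \<Rightarrow> (('t \<Rightarrow> complex) \<Rightarrow> complex) \<Rightarrow> 't set \<Rightarrow> bool" where
  "loc_negligible T \<mu> A \<longleftrightarrow>
     (\<forall>K. compactin T K \<longrightarrow> upper_integral T \<mu> (indicator (A \<inter> K)) = 0)"

text \<open>The space of integrable functions is the closure of \<open>Cc T\<close> for \<open>f \<mapsto> |\<mu>|\<^sup>*(|f|)\<close>, and the
  integral is the continuous extension of \<open>\<mu>\<close>.\<close>
definition has_radon_integral ::
  "'t topology \<Rightarrow> (('t \<Rightarrow> complex) \<Rightarrow> complex) \<Rightarrow> ('t \<Rightarrow> complex) \<Rightarrow> complex \<Rightarrow> bool" where
  "has_radon_integral T \<mu> f I \<longleftrightarrow> (\<exists>g. (\<forall>n. g n \<in> Cc T) \<and>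
     (\<lambda>n. upper_integral T \<mu> (\<lambda>t. ennreal (cmod (f t - g n t)))) \<longlonglongrightarrow> 0 \<and>
     (\<lambda>n. \<mu> (g n)) \<longlonglongrightarrow> I)"

text \<open>Essentially integrable functions agree locally almost everywhere with an integrable one.\<close>
definition has_ess_integral ::
  "'t topology \<Rightarrow> (('t \<Rightarrow> complex) \<Rightarrow> complex) \<Rightarrow> ('t \<Rightarrow> complex) \<Rightarrow> complex \<Rightarrow> bool" where
  "has_ess_integral T \<mu> f I \<longleftrightarrow> (\<exists>g. has_radon_integral T \<mu> g I \<and>
     loc_negligible T \<mu> {t \<in> topspace T. f t \<noteq> g t})"

definition ess_integrable ::
  "'t topology \<Rightarrow> (('t \<Rightarrow> complex) \<Rightarrow> complex) \<Rightarrow> ('t \<Rightarrow> complex) \<Rightarrow> bool" where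
  "ess_integrable T \<mu> f \<longleftrightarrow> (\<exists>I. has_ess_integral T \<mu> f I)"

definition ess_integral ::
  "'t topology \<Rightarrow> (('t \<Rightarrow> complex) \<Rightarrow> complex) \<Rightarrow> ('t \<Rightarrow> complex) \<Rightarrow> complex" where
  "ess_integral T \<mu> f = (THE I. has_ess_integral T \<mu> f I)"

section \<open>Weak integrals\<close>

definition is_weak_integral ::
  "'t topology \<Rightarrow> (('t \<Rightarrow> complex) \<Rightarrow> complex) \<Rightarrow> 'a::cvec set \<Rightarrow> 'a topology \<Rightarrow> ('t \<Rightarrow> 'a) \<Rightarrow> 'a
     \<Rightarrow> bool" where
  "is_weak_integral T \<mu> V TV F a \<longleftrightarrow>
     a \<in> V \<and> (\<forall>\<phi>\<in>dual_sp V TV. \<phi> a = ess_integral T \<mu> (\<lambda>t. \<phi> (F t)))"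

definition L1_sp ::
  "'t topology \<Rightarrow> (('t \<Rightarrow> complex) \<Rightarrow> complex) \<Rightarrow> 'a::cvec set \<Rightarrow> 'a topology \<Rightarrow> ('t \<Rightarrow> 'a) set"
  where
  "L1_sp T \<mu> V TV = {F \<in> prod_sp (topspace T) (\<lambda>_. V).
     (\<forall>\<phi>\<in>dual_sp V TV. ess_integrable T \<mu> (\<lambda>t. \<phi> (F t))) \<and>
     (\<exists>a. is_weak_integral T \<mu> V TV F a)}"

definition weak_integral ::
  "'t topology \<Rightarrow> (('t \<Rightarrow> complex) \<Rightarrow> complex) \<Rightarrow> 'a::cvec set \<Rightarrow> 'a topology \<Rightarrow> ('t \<Rightarrow> 'a) \<Rightarrow> 'a"
  where
  "weak_integral T \<mu> V TV F = (THE a. is_weak_integral T \<mu> V TV F a)"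

section \<open>Consistent classes of data and the associated objects\<close>

definition theta ::
  "'x set \<Rightarrow> ('x \<Rightarrow> 'e::cvec set) \<Rightarrow> ('x \<Rightarrow> 'e \<Rightarrow> 'e) \<Rightarrow> ('x \<Rightarrow> 'e) \<Rightarrow> 'x \<Rightarrow> 'e" where
  "theta X E u = restr (prod_sp X E) (\<lambda>v x. u x (v x))"

text \<open>\<open>E x\<close> carries the topology \<open>TE x\<close> with fundamental set of seminorms \<open>nu x j\<close>, \<open>j \<in> J x\<close>;
  \<open>tau x\<close> is the topology on the continuous endomorphisms of \<open>E x\<close>, and \<open>TH\<close> the one on \<open>H\<close>.\<close>
locale consistent_data =
  fixes X :: "'x set"
    and Y :: "'y topology"
    and \<mu> :: "('y \<Rightarrow> complex) \<Rightarrow> complex"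
    and E :: "'x \<Rightarrow> 'e::cvec set"
    and TE :: "'x \<Rightarrow> 'e topology"
    and J :: "'x \<Rightarrow> 'j set"
    and nu :: "'x \<Rightarrow> 'j \<Rightarrow> 'e \<Rightarrow> real"
    and tau :: "'x \<Rightarrow> ('e \<Rightarrow> 'e) topology"
    and H :: "('x \<Rightarrow> 'e) set"
    and TH :: "('x \<Rightarrow> 'e) topology"
    and A :: "('x \<Rightarrow> 'e \<Rightarrow> 'e) set"
  assumes Y_locally_compact: "locally_compact_space Y" "Hausdorff_space Y"
    and Y_radon: "radon_measure Y \<mu>"
    and E_hlcs: "x \<in> X \<Longrightarrow> hlcs (E x) (TE x)"
    and nu_seminorm: "x \<in> X \<Longrightarrow> j \<in> J x \<Longrightarrow> seminorm_on (E x) (nu x j)"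
    and nu_fundamental: "x \<in> X \<Longrightarrow> TE x = seminorm_topology (E x) (nu x ` J x)"
    and tau_hlcs: "x \<in> X \<Longrightarrow> hlcs (cont_End (E x) (TE x)) (tau x)"
    and H_hlcs: "hlcs H TH"
    and H_subset: "H \<subseteq> prod_sp X E"
    and iota_in_H: "x \<in> X \<Longrightarrow> iota x ` E x \<subseteq> H"
    and Pr_continuous: "x \<in> X \<Longrightarrow> continuous_map TH (TE x) (\<lambda>v. v x)"
    and iota_continuous: "x \<in> X \<Longrightarrow> continuous_map (TE x) TH (iota x)"
    and A_subspace: "cvs.subspace A"
    and A_subset: "A \<subseteq> prod_sp X (\<lambda>x. cont_End (E x) (TE x))"
    and A_theta: "u \<in> A \<Longrightarrow> restr H (theta X E u) \<in> cont_End H TH"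
    and iota_in_A: "x \<in> X \<Longrightarrow> iota x ` cont_End (E x) (TE x) \<subseteq> A"

definition G_sp ::
  "'x set \<Rightarrow> ('x \<Rightarrow> 'e::cvec set) \<Rightarrow> ('x \<Rightarrow> 'e) set \<Rightarrow> ('x \<Rightarrow> 'e \<Rightarrow> 'e) set
     \<Rightarrow> (('x \<Rightarrow> 'e) \<Rightarrow> 'x \<Rightarrow> 'e) set" where
  "G_sp X E H A = (\<lambda>u. restr H (theta X E u)) ` A"

definition h_map ::
  "('x \<Rightarrow> 'e::cvec) set \<Rightarrow> 'x \<Rightarrow> ('e \<Rightarrow> 'e) \<Rightarrow> ('x \<Rightarrow> 'e) \<Rightarrow> 'x \<Rightarrow> 'e" where
  "h_map H x f = restr H (\<lambda>v. iota x (f (v x)))"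

definition G_top ::
  "'x set \<Rightarrow> ('x \<Rightarrow> 'e::cvec set) \<Rightarrow> ('x \<Rightarrow> ('e \<Rightarrow> 'e) topology) \<Rightarrow> ('x \<Rightarrow> 'e) set
     \<Rightarrow> ('x \<Rightarrow> 'e \<Rightarrow> 'e) set \<Rightarrow> (('x \<Rightarrow> 'e) \<Rightarrow> 'x \<Rightarrow> 'e) topology" where
  "G_top X E tau H A = finest_lc_topology (G_sp X E H A) X tau (h_map H)"

definition Psi ::
  "'x set \<Rightarrow> ('x \<Rightarrow> 'e::cvec set) \<Rightarrow> 't topology \<Rightarrow> ('t \<Rightarrow> ('x \<Rightarrow> 'e) \<Rightarrow> 'x \<Rightarrow> 'e)
     \<Rightarrow> 'x \<Rightarrow> 't \<Rightarrow> 'e \<Rightarrow> 'e" where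
  "Psi X E T F = restr X (\<lambda>x. restr (topspace T) (\<lambda>s. restr (E x) (\<lambda>z. F s (iota x z) x)))"

text \<open>The locally compact spaces \<open>T\<close> range over all topologies on subsets of the type \<open>'t\<close>, which
  is a parameter because HOL cannot quantify over types inside a definition.\<close>
definition U_space ::
  "'t itself \<Rightarrow> 'x set \<Rightarrow> ('x \<Rightarrow> 'e::cvec set) \<Rightarrow> ('x \<Rightarrow> 'e topology) \<Rightarrow>
     ('x \<Rightarrow> ('e \<Rightarrow> 'e) topology) \<Rightarrow> ('x \<Rightarrow> 'e) set \<Rightarrow> ('x \<Rightarrow> 'e) topology \<Rightarrow> ('x \<Rightarrow> 'e) set \<Rightarrow>
     (('x \<Rightarrow> 'e) \<Rightarrow> 'x \<Rightarrow> 'e) set \<Rightarrow> (('x \<Rightarrow> 'e) \<Rightarrow> 'x \<Rightarrow> 'e) topology \<Rightarrow> bool" where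
  "U_space _ X E TE tau H TH D G TG \<longleftrightarrow>
     hlcs G TG \<and> G \<subseteq> cont_End H TH \<and> D \<subseteq> H \<and>
     (\<forall>T :: 't topology. locally_compact_space T \<and> Hausdorff_space T \<longrightarrow>
       (\<exists>\<Psi> \<in> lin_maps (prod_sp (topspace T) (\<lambda>_. End_sp H))
                      (prod_sp X (\<lambda>x. prod_sp (topspace T) (\<lambda>_. End_sp (E x)))).
         \<forall>\<nu>. radon_measure T \<nu> \<longrightarrow>
           \<Psi> ` L1_sp T \<nu> G TG \<subseteq> prod_sp X (\<lambda>x. L1_sp T \<nu> (cont_End (E x) (TE x)) (tau x)) \<and>
           (\<forall>F \<in> L1_sp T \<nu> G TG. \<forall>v\<in>D. \<forall>x\<in>X.
              weak_integral T \<nu> (cont_End (E x) (TE x)) (tau x) (\<Psi> F x) (v x)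
                = weak_integral T \<nu> G TG F v x)))"

end

theory Submission
  imports Defs
begin

text \<open>
  Composed with the maps \<open>h_map H y\<close>, the coordinate map \<open>g \<mapsto> Pr x \<circ> g \<circ> iota x\<close> is the
  identity for \<open>y = x\<close> and zero otherwise, so it is continuous on the final topology of \<open>G\<close>. These
  maps separate the points of \<open>G\<close>, which is therefore Hausdorff. Boundedness of the sets \<open>B x l\<close>
  makes evaluation at their points continuous. Weak integrals commute with continuous linear maps,
  and on a diagonal operator \<open>g\<close> the coordinate map followed by evaluation at \<open>v x\<close> yields
  \<open>g v x\<close>. By Hahn--Banach the continuous dual separates points, so weak integrals are unique.
\<close>

section \<open>Seminorm topologies\<close>

text \<open>The images of the maps \<open>h_map H x\<close> span only the operators of finitely
  supported families, so in general neither the Hausdorff property nor an equation between operators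
  can be checked on them. Everything therefore passes through continuous linear maps out of
  \<open>G\<close>. These are accessible because the final topology is generated by all seminorms on
  \<open>G\<close> whose pullbacks along every \<open>h_map H x\<close> are continuous: it is enough
  that a seminorm of \<open>tau x\<close> composed with a coordinate map is of this kind. Weak
  integrals are given by \<open>THE\<close>, so they can be evaluated only once uniqueness is known;
  hence the Hausdorff property of \<open>G\<close> precedes every statement about its
  integrals.\<close>

lemma topspace_seminorm_topology [simp]: "topspace (seminorm_topology V P) = V"
  unfolding seminorm_topology_def topology_generated_by_topspace by auto

lemma topspace_hlcs: "hlcs V T \<Longrightarrow> topspace T = V"
  by (auto simp: hlcs_def locally_convex_def)

lemma subspace_hlcs: "hlcs V T \<Longrightarrow> cvs.subspace V"
  by (auto simp: hlcs_def locally_convex_def)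

lemma openin_seminorm_ball:
  "p \<in> P \<Longrightarrow> a \<in> V \<Longrightarrow> 0 < e \<Longrightarrow> openin (seminorm_topology V P) {b \<in> V. p (b - a) < e}"
  unfolding seminorm_topology_def by (rule topology_generated_by_Basis) blast

text \<open>More seminorms give more subbasic balls. This is what makes the largest admissible set
  of seminorms generate the finest topology.\<close>

lemma seminorm_topology_mono:
  assumes "P \<subseteq> Q" "openin (seminorm_topology V P) U"
  shows "openin (seminorm_topology V Q) U"
proof -
  have "generate_topology_on
      (insert V {{b \<in> V. p (b - a) < e} | p a e. p \<in> P \<and> a \<in> V \<and> 0 < e}) U"
    using assms(2) unfolding seminorm_topology_def openin_topology_generated_by_iff .
  then have "generate_topology_on
      (insert V {{b \<in> V. p (b - a) < e} | p a e. p \<in> Q \<and> a \<in> V \<and> 0 < e}) U"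
  proof induction
    case (Basis s)
    then show ?case using assms(1) by (intro generate_topology_on.Basis) blast
  qed (auto intro: generate_topology_on.intros)
  then show ?thesis
    unfolding seminorm_topology_def openin_topology_generated_by_iff .
qed

text \<open>Continuity is tested on the subbasis. Since \<open>V\<close> itself is a subbasic set,
  the range condition has to be listed separately.\<close>

lemma continuous_map_seminorm_topology_iff:
  "continuous_map T (seminorm_topology V P) f \<longleftrightarrow> f ` topspace T \<subseteq> V \<and>
     (\<forall>p\<in>P. \<forall>a\<in>V. \<forall>e>0. openin T {t \<in> topspace T. p (f t - a) < e})"
  (is "?l \<longleftrightarrow> ?r")
proof
  assume l: ?l
  have "openin T {t \<in> topspace T. p (f t - a) < e}" if "p \<in> P" "a \<in> V" "0 < e" for p a e
  proof -
    have "openin T {t \<in> topspace T. f t \<in> {b \<in> V. p (b - a) < e}}"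
      using l openin_seminorm_ball[OF that] by (rule openin_continuous_map_preimage)
    moreover have "{t \<in> topspace T. f t \<in> {b \<in> V. p (b - a) < e}}
        = {t \<in> topspace T. p (f t - a) < e}"
      using continuous_map_image_subset_topspace[OF l] by auto
    ultimately show ?thesis by simp
  qed
  then show ?r using continuous_map_image_subset_topspace[OF l] by auto
next
  assume r: ?r
  have "openin T (f -` U \<inter> topspace T)"
    if U: "U \<in> insert V {{b \<in> V. p (b - a) < e} | p a e. p \<in> P \<and> a \<in> V \<and> 0 < e}" for U
  proof (cases "U = V")
    case True
    then have "f -` U \<inter> topspace T = topspace T" using r by auto
    then show ?thesis by simp
  next
    case False
    then obtain p a e where *: "U = {b \<in> V. p (b - a) < e}" "p \<in> P" "a \<in> V" "0 < e"
      using U by auto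
    then have "f -` U \<inter> topspace T = {t \<in> topspace T. p (f t - a) < e}" using r by auto
    then show ?thesis using r * by simp
  qed
  moreover have "f ` topspace T
      \<subseteq> \<Union> (insert V {{b \<in> V. p (b - a) < e} | p a e. p \<in> P \<and> a \<in> V \<and> 0 < e})"
    using r by auto
  ultimately show ?l
    unfolding seminorm_topology_def continuous_on_generated_topo_iff by blast
qed

lemma seminorm_on_triangle:
  assumes "seminorm_on V p" "cvs.subspace V" "a \<in> V" "b \<in> V" "c \<in> V"
  shows "p (a - c) \<le> p (a - b) + p (b - c)"
proof -
  have "p ((a - b) + (b - c)) \<le> p (a - b) + p (b - c)"
    using assms unfolding seminorm_on_def by (blast intro: cvs.subspace_diff)
  then show ?thesis by simp
qed

lemma seminorm_on_zero: "seminorm_on V p \<Longrightarrow> cvs.subspace V \<Longrightarrow> p 0 = 0"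
  using cvs.subspace_0[of V] unfolding seminorm_on_def
  by (metis cvs.scale_zero_left mult_zero_left norm_zero)

lemma seminorm_on_minus: "seminorm_on V p \<Longrightarrow> a \<in> V \<Longrightarrow> p (- a) = p a"
  unfolding seminorm_on_def
  by (metis cvs.scale_minus_left cvs.scale_one norm_minus_cancel norm_one mult_1)

text \<open>By the triangle inequality, a ball about \<open>a\<close> containing \<open>f t0\<close>
  contains the ball about \<open>f t0\<close> whose radius is the remaining slack
  \<open>e - p (f t0 - a)\<close>. So only balls centred at values of \<open>f\<close> need to be
  tested.\<close>

lemma continuous_map_seminorm_topologyI:
  assumes V: "cvs.subspace V" and P: "\<And>p. p \<in> P \<Longrightarrow> seminorm_on V p"
    and f: "\<And>t. t \<in> topspace T \<Longrightarrow> f t \<in> V"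
    and nbhd: "\<And>p t0 e. p \<in> P \<Longrightarrow> t0 \<in> topspace T \<Longrightarrow> 0 < e \<Longrightarrow>
      \<exists>U. openin T U \<and> t0 \<in> U \<and> (\<forall>t\<in>U. p (f t - f t0) < e)"
  shows "continuous_map T (seminorm_topology V P) f"
  unfolding continuous_map_seminorm_topology_iff
proof (intro conjI ballI allI impI)
  fix p a and e :: real assume p: "p \<in> P" and a: "a \<in> V" and "0 < e"
  show "openin T {t \<in> topspace T. p (f t - a) < e}"
  proof (subst openin_subopen, intro ballI)
    fix t0 assume "t0 \<in> {t \<in> topspace T. p (f t - a) < e}"
    then have t0: "t0 \<in> topspace T" "p (f t0 - a) < e" by auto
    then obtain U where U: "openin T U" "t0 \<in> U" "\<forall>t\<in>U. p (f t - f t0) < e - p (f t0 - a)"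
      using nbhd[OF p t0(1), of "e - p (f t0 - a)"] by auto
    have "p (f t - a) < e" "t \<in> topspace T" if "t \<in> U" for t
    proof -
      show t: "t \<in> topspace T" using U(1) that openin_subset by blast
      show "p (f t - a) < e"
        using seminorm_on_triangle[OF P[OF p] V f[OF t] f[OF t0(1)] a] U(3) that by fastforce
    qed
    then show "\<exists>U. openin T U \<and> t0 \<in> U \<and> U \<subseteq> {t \<in> topspace T. p (f t - a) < e}"
      using U by blast
  qed
qed (use f in auto)

text \<open>If every seminorm vanished at \<open>a - b\<close>, each subbasic ball would contain
  both points or neither; this passes to all generated open sets and contradicts the Hausdorff
  property.\<close>

lemma hlcs_separating_seminorm:
  assumes V: "cvs.subspace V" and P: "\<And>p. p \<in> P \<Longrightarrow> seminorm_on V p"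
    and haus: "Hausdorff_space (seminorm_topology V P)" and "a \<in> V" "b \<in> V" "a \<noteq> b"
  shows "\<exists>p\<in>P. 0 < p (a - b)"
proof (rule ccontr)
  assume "\<not> ?thesis"
  then have zero: "p (a - b) = 0" if "p \<in> P" for p
    using P[OF that] that cvs.subspace_diff[OF V \<open>a \<in> V\<close> \<open>b \<in> V\<close>]
    unfolding seminorm_on_def by (metis antisym not_less)
  have "a \<in> U \<longleftrightarrow> b \<in> U" if "openin (seminorm_topology V P) U" for U
  proof -
    have "generate_topology_on
        (insert V {{b \<in> V. p (b - a) < e} | p a e. p \<in> P \<and> a \<in> V \<and> 0 < e}) U"
      using that unfolding seminorm_topology_def openin_topology_generated_by_iff .
    then show ?thesis
    proof induction
      case (Basis s)
      show ?case
      proof (cases "s = V")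
        case False
        then obtain p c e where s: "s = {b \<in> V. p (b - c) < e}" and p: "p \<in> P" and c: "c \<in> V"
          using Basis by auto
        have "p (b - a) = 0"
          using zero[OF p] seminorm_on_minus[OF P[OF p] cvs.subspace_diff[OF V \<open>a \<in> V\<close> \<open>b \<in> V\<close>]]
          by simp
        then have "p (a - c) = p (b - c)"
          using seminorm_on_triangle[OF P[OF p] V \<open>a \<in> V\<close> \<open>b \<in> V\<close> c]
            seminorm_on_triangle[OF P[OF p] V \<open>b \<in> V\<close> \<open>a \<in> V\<close> c] zero[OF p] by linarith
        then show ?thesis using s \<open>a \<in> V\<close> \<open>b \<in> V\<close> by auto
      qed (use assms in auto)
    qed auto
  qed
  then show False
    using haus \<open>a \<in> V\<close> \<open>b \<in> V\<close> \<open>a \<noteq> b\<close> unfolding Hausdorff_space_def disjnt_def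
    by (metis IntI empty_iff topspace_seminorm_topology)
qed

section \<open>The Hahn--Banach theorem\<close>

text \<open>A minimal sublinear functional is linear, since \<open>tilt q y\<close> is a sublinear functional
  below \<open>q\<close>; this avoids extending functionals from subspaces.\<close>

definition sublinear_on :: "'a::cvec set \<Rightarrow> ('a \<Rightarrow> real) \<Rightarrow> bool" where
  "sublinear_on V q \<longleftrightarrow> (\<forall>x\<in>V. \<forall>y\<in>V. q (x + y) \<le> q x + q y)
     \<and> (\<forall>t>0. \<forall>x\<in>V. q (complex_of_real t *\<^sub>C x) \<le> t * q x)"

lemma sublinear_on_add: "sublinear_on V q \<Longrightarrow> x \<in> V \<Longrightarrow> y \<in> V \<Longrightarrow> q (x + y) \<le> q x + q y"
  by (simp add: sublinear_on_def)

lemma sublinear_on_scale_le: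
  "sublinear_on V q \<Longrightarrow> 0 < t \<Longrightarrow> x \<in> V \<Longrightarrow> q (complex_of_real t *\<^sub>C x) \<le> t * q x"
  by (simp add: sublinear_on_def)

text \<open>The factors 2 and 1/2 bound \<open>q 0\<close> from below and from above by
  zero.\<close>

lemma sublinear_on_zero:
  assumes "sublinear_on V q" "cvs.subspace V"
  shows "q 0 = 0"
  using sublinear_on_scale_le[OF assms(1) _ cvs.subspace_0[OF assms(2)], of 2]
    sublinear_on_scale_le[OF assms(1) _ cvs.subspace_0[OF assms(2)], of "1/2"] by simp

text \<open>The definition asks only for an inequality at positive factors, a form that survives
  infima; applying it to the inverse factor recovers equality.\<close>

lemma sublinear_on_scale:
  assumes q: "sublinear_on V q" and V: "cvs.subspace V" and "0 \<le> t" "x \<in> V"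
  shows "q (complex_of_real t *\<^sub>C x) = t * q x"
proof (cases "t = 0")
  case True
  then show ?thesis using sublinear_on_zero[OF q V] by simp
next
  case False
  then have t: "0 < t" using \<open>0 \<le> t\<close> by simp
  have "q (complex_of_real (inverse t) *\<^sub>C complex_of_real t *\<^sub>C x)
      \<le> inverse t * q (complex_of_real t *\<^sub>C x)"
    using t V \<open>x \<in> V\<close> by (intro sublinear_on_scale_le[OF q]) (auto intro: cvs.subspace_scale)
  moreover have "complex_of_real (inverse t) *\<^sub>C complex_of_real t *\<^sub>C x = x"
    using t by (simp add: scaleC_scaleC scaleC_one flip: of_real_mult)
  ultimately have "t * q x \<le> q (complex_of_real t *\<^sub>C x)"
    using t by (simp add: field_simps)
  then show ?thesis using sublinear_on_scale_le[OF q t \<open>x \<in> V\<close>] by simp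
qed

text \<open>This supplies the common lower bound \<open>- p (- x)\<close> for all sublinear
  functionals below \<open>p\<close>, which keeps infima over chains finite.\<close>

lemma sublinear_on_minus_ge:
  assumes q: "sublinear_on V q" and V: "cvs.subspace V" and "x \<in> V"
  shows "- q (- x) \<le> q x"
  using sublinear_on_add[OF q \<open>x \<in> V\<close> cvs.subspace_neg[OF V \<open>x \<in> V\<close>]] sublinear_on_zero[OF q V]
  by simp

lemma le_cINF_add:
  fixes f g :: "'i \<Rightarrow> real"
  assumes "I \<noteq> {}" "\<And>i j. i \<in> I \<Longrightarrow> j \<in> I \<Longrightarrow> u \<le> f i + g j"
  shows "u \<le> (INF i\<in>I. f i) + (INF j\<in>I. g j)"
proof -
  have "u - (INF i\<in>I. f i) \<le> g j" if "j \<in> I" for j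
  proof -
    have "u - g j \<le> (INF i\<in>I. f i)"
      using assms that by (intro cINF_greatest) (auto simp: algebra_simps)
    then show ?thesis by simp
  qed
  then have "u - (INF i\<in>I. f i) \<le> (INF j\<in>I. g j)"
    using assms(1) by (intro cINF_greatest) auto
  then show ?thesis by simp
qed

lemma le_mult_cINF:
  fixes f :: "'i \<Rightarrow> real"
  assumes "I \<noteq> {}" "0 < t" "\<And>i. i \<in> I \<Longrightarrow> u \<le> t * f i"
  shows "u \<le> t * (INF i\<in>I. f i)"
proof -
  have "u / t \<le> (INF i\<in>I. f i)"
    using assms by (intro cINF_greatest) (auto simp: field_simps)
  then show ?thesis using assms(2) by (simp add: field_simps)
qed

text \<open>For sublinear \<open>q\<close> on a subspace containing \<open>y\<close>, this is the
  largest sublinear functional below \<open>q\<close> whose value at \<open>- y\<close> is at most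
  \<open>- q y\<close>.\<close>

definition tilt :: "('a::cvec \<Rightarrow> real) \<Rightarrow> 'a \<Rightarrow> 'a \<Rightarrow> real" where
  "tilt q y x = (INF t\<in>{0..}. q (x + complex_of_real t *\<^sub>C y) - t * q y)"

text \<open>The point is that the infimum is over a set bounded below:
  \<open>s * q y = q (s y) \<le> q (x + s y) + q (- x)\<close> yields the bound
  \<open>- q (- x)\<close>, independent of \<open>s\<close>.\<close>

lemma tilt_le:
  assumes q: "sublinear_on V q" and V: "cvs.subspace V" and "x \<in> V" "y \<in> V" "0 \<le> t"
  shows "tilt q y x \<le> q (x + complex_of_real t *\<^sub>C y) - t * q y"
proof -
  have "- q (- x) \<le> q (x + complex_of_real s *\<^sub>C y) - s * q y" if "0 \<le> s" for s
  proof -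
    have "q ((x + complex_of_real s *\<^sub>C y) + - x) \<le> q (x + complex_of_real s *\<^sub>C y) + q (- x)"
      using assms
      by (intro sublinear_on_add[OF q] cvs.subspace_neg cvs.subspace_add cvs.subspace_scale)
    moreover have "(x + complex_of_real s *\<^sub>C y) + - x = complex_of_real s *\<^sub>C y" by simp
    ultimately show ?thesis using sublinear_on_scale[OF q V that \<open>y \<in> V\<close>] by simp
  qed
  then show ?thesis
    unfolding tilt_def using \<open>0 \<le> t\<close>
    by (intro cINF_lower bdd_belowI2[where m = "- q (- x)"]) auto
qed

text \<open>Parameters \<open>s\<close> and \<open>t\<close> for the two summands combine to the
  parameter \<open>s + t\<close> for the sum; scaling by \<open>s\<close> turns the parameter
  \<open>t\<close> into \<open>s * t\<close>.\<close>

lemma sublinear_on_tilt: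
  assumes q: "sublinear_on V q" and V: "cvs.subspace V" and "y \<in> V"
  shows "sublinear_on V (tilt q y)"
  unfolding sublinear_on_def
proof (intro conjI ballI allI impI)
  fix a b assume ab: "a \<in> V" "b \<in> V"
  show "tilt q y (a + b) \<le> tilt q y a + tilt q y b"
    unfolding tilt_def[of q y a] tilt_def[of q y b]
  proof (rule le_cINF_add)
    fix s t :: real assume st: "s \<in> {0..}" "t \<in> {0..}"
    have "tilt q y (a + b) \<le> q ((a + b) + complex_of_real (s + t) *\<^sub>C y) - (s + t) * q y"
      using st ab assms by (intro tilt_le[OF q V]) (auto intro: cvs.subspace_add)
    moreover have "(a + b) + complex_of_real (s + t) *\<^sub>C y
        = (a + complex_of_real s *\<^sub>C y) + (b + complex_of_real t *\<^sub>C y)"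
      by (simp add: scaleC_add_left algebra_simps)
    moreover have "q ((a + complex_of_real s *\<^sub>C y) + (b + complex_of_real t *\<^sub>C y))
        \<le> q (a + complex_of_real s *\<^sub>C y) + q (b + complex_of_real t *\<^sub>C y)"
      using ab assms by (intro sublinear_on_add[OF q] cvs.subspace_add cvs.subspace_scale)
    ultimately show "tilt q y (a + b) \<le> (q (a + complex_of_real s *\<^sub>C y) - s * q y)
        + (q (b + complex_of_real t *\<^sub>C y) - t * q y)"
      by (simp add: algebra_simps)
  qed auto
next
  fix s :: real and a assume s: "0 < s" and a: "a \<in> V"
  show "tilt q y (complex_of_real s *\<^sub>C a) \<le> s * tilt q y a"
    unfolding tilt_def[of q y a]
  proof (rule le_mult_cINF)
    fix t :: real assume t: "t \<in> {0..}"
    have "tilt q y (complex_of_real s *\<^sub>C a)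
        \<le> q (complex_of_real s *\<^sub>C a + complex_of_real (s * t) *\<^sub>C y) - (s * t) * q y"
      using s t a assms by (intro tilt_le[OF q V]) (auto intro: cvs.subspace_scale)
    moreover have "complex_of_real s *\<^sub>C a + complex_of_real (s * t) *\<^sub>C y
        = complex_of_real s *\<^sub>C (a + complex_of_real t *\<^sub>C y)"
      by (simp add: scaleC_add_right scaleC_scaleC)
    moreover have "q (complex_of_real s *\<^sub>C (a + complex_of_real t *\<^sub>C y))
        \<le> s * q (a + complex_of_real t *\<^sub>C y)"
      using s a assms
      by (intro sublinear_on_scale_le[OF q] cvs.subspace_add cvs.subspace_scale)
    ultimately show "tilt q y (complex_of_real s *\<^sub>C a)
        \<le> s * (q (a + complex_of_real t *\<^sub>C y) - t * q y)"
      by (simp add: algebra_simps)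
  qed (use s in auto)
qed

text \<open>Zorn's lemma is applied to the reversed pointwise order, so its maximal elements are
  minimal functionals and the bound of a chain is its pointwise infimum.\<close>

lemma exists_minimal_sublinear:
  assumes p: "sublinear_on V p" and V: "cvs.subspace V"
  shows "\<exists>q. sublinear_on V q \<and> (\<forall>x\<in>V. q x \<le> p x) \<and>
    (\<forall>r. sublinear_on V r \<and> (\<forall>x\<in>V. r x \<le> q x) \<longrightarrow> (\<forall>x\<in>V. r x = q x))"
proof -
  \<comment> \<open>Values outside \<open>V\<close> are frozen at 0, so that comparing functions on
    the whole type amounts to comparing them on \<open>V\<close>.\<close>
  define Q where "Q = {q. sublinear_on V q \<and> (\<forall>x\<in>V. q x \<le> p x) \<and> (\<forall>x. x \<notin> V \<longrightarrow> q x = 0)}"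
  define below where "below = (\<lambda>q r :: 'a \<Rightarrow> real. \<forall>x. r x \<le> q x)"
  have cong: "sublinear_on V (restr V r) \<longleftrightarrow> sublinear_on V r" for r
    using V unfolding sublinear_on_def restr_def
    by (simp add: cvs.subspace_add cvs.subspace_scale)
  have po: "partial_order_on Q (relation_of below Q)"
    by (rule partial_order_on_relation_ofI)
      (auto simp: below_def fun_eq_iff intro: order_trans antisym)
  have chain: "\<exists>u\<in>Q. \<forall>q\<in>C. below q u" if C: "C \<in> Chains (relation_of below Q)" for C
  proof (cases "C = {}")
    case True
    have "restr V p \<in> Q" using p cong[of p] unfolding Q_def by (auto simp: restr_def)
    then show ?thesis using True by blast
  next
    case False
    have CQ: "q \<in> Q" if "q \<in> C" for q
      using C that unfolding Chains_def relation_of_def by blast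
    have lin: "below q r \<or> below r q" if "q \<in> C" "r \<in> C" for q r
      using C that unfolding Chains_def relation_of_def by blast
    define u where "u = (\<lambda>x. if x \<in> V then INF q\<in>C. q x else 0)"
    have lower: "u x \<le> q x" if "q \<in> C" "x \<in> V" for q x
    proof -
      have "- p (- x) \<le> r x" if "r \<in> C" for r
      proof -
        have r: "sublinear_on V r" "\<forall>x\<in>V. r x \<le> p x" using CQ[OF that] by (auto simp: Q_def)
        show ?thesis
          using sublinear_on_minus_ge[OF r(1) V \<open>x \<in> V\<close>] r(2) cvs.subspace_neg[OF V \<open>x \<in> V\<close>]
          by fastforce
      qed
      then show ?thesis
        using that by (auto simp: u_def intro!: cINF_lower bdd_belowI2[where m = "- p (- x)"])
    qed
    have "sublinear_on V u"
      unfolding sublinear_on_def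
    proof (intro conjI ballI allI impI)
      fix x y assume xy: "x \<in> V" "y \<in> V"
      have "u (x + y) \<le> q x + r y" if qr: "q \<in> C" "r \<in> C" for q r
      proof -
        \<comment> \<open>Subadditivity of the infimum needs one functional below both
          \<open>q\<close> and \<open>r\<close>; in a chain one of the two serves.\<close>
        obtain s where s: "s \<in> C" "below q s" "below r s"
          using lin[OF qr] qr unfolding below_def by (metis order_refl)
        have "u (x + y) \<le> s (x + y)" using lower s xy V by (simp add: cvs.subspace_add)
        also have "\<dots> \<le> s x + s y" using CQ[OF s(1)] xy by (auto simp: Q_def sublinear_on_add)
        also have "\<dots> \<le> q x + r y" using s unfolding below_def by (simp add: add_mono)
        finally show ?thesis .
      qed
      then show "u (x + y) \<le> u x + u y"
        using le_cINF_add[OF False, of "u (x + y)" "\<lambda>q. q x" "\<lambda>q. q y"] xy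
        by (simp add: u_def)
    next
      fix t :: real and x assume t: "0 < t" and x: "x \<in> V"
      have "u (complex_of_real t *\<^sub>C x) \<le> t * q x" if "q \<in> C" for q
        using lower[OF that cvs.subspace_scale[OF V x]] CQ[OF that] sublinear_on_scale_le[OF _ t x]
        unfolding Q_def by (metis (mono_tags, lifting) mem_Collect_eq order_trans)
      then show "u (complex_of_real t *\<^sub>C x) \<le> t * u x"
        using le_mult_cINF[OF False t, of "u (complex_of_real t *\<^sub>C x)" "\<lambda>q. q x"] x
        by (simp add: u_def)
    qed
    moreover have "u x \<le> p x" if "x \<in> V" for x
    proof -
      obtain q where "q \<in> C" using False by blast
      then show ?thesis using lower[OF _ that] CQ that unfolding Q_def by fastforce
    qed
    ultimately have "u \<in> Q" unfolding Q_def by (simp add: u_def)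
    moreover have "below q u" if "q \<in> C" for q
      unfolding below_def
    proof
      fix x show "u x \<le> q x"
        using lower[OF that] CQ[OF that] by (cases "x \<in> V") (auto simp: u_def Q_def)
    qed
    ultimately show ?thesis by blast
  qed
  from predicate_Zorn[OF po chain] obtain q
    where q: "q \<in> Q" and min: "\<And>r. r \<in> Q \<Longrightarrow> below q r \<Longrightarrow> r = q" by blast
  have "r x = q x" if r: "sublinear_on V r" "\<forall>x\<in>V. r x \<le> q x" and x: "x \<in> V" for r x
  proof -
    have "restr V r \<in> Q" using r q cong[of r] unfolding Q_def restr_def by fastforce
    moreover have "below q (restr V r)" using r(2) q unfolding below_def restr_def Q_def by simp
    ultimately have "restr V r = q" by (rule min)
    then show ?thesis using x by (auto simp: restr_def)
  qed
  then show ?thesis using q unfolding Q_def by blast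
qed

text \<open>The parameter 0 shows \<open>tilt q y\<close> to lie below \<open>q\<close>, so
  minimality makes them equal; the parameter 1 then gives the missing inequality
  \<open>q x + q y \<le> q (x + y)\<close>.\<close>

lemma minimal_sublinear_add:
  assumes q: "sublinear_on V q" and V: "cvs.subspace V"
    and min: "\<And>r. sublinear_on V r \<Longrightarrow> (\<forall>x\<in>V. r x \<le> q x) \<Longrightarrow> (\<forall>x\<in>V. r x = q x)"
    and xy: "x \<in> V" "y \<in> V"
  shows "q (x + y) = q x + q y"
proof -
  have "\<forall>z\<in>V. tilt q y z \<le> q z"
    using tilt_le[OF q V _ xy(2), of _ 0] by simp
  then have "tilt q y x = q x"
    using min[OF sublinear_on_tilt[OF q V xy(2)]] xy by blast
  then have "q x \<le> q (x + y) - q y"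
    using tilt_le[OF q V xy, of 1] by (simp add: scaleC_one)
  then show ?thesis using sublinear_on_add[OF q xy] by simp
qed

text \<open>The minimal functional is taken below \<open>tilt p y\<close> rather than below
  \<open>p\<close>: the tilt is at most \<open>- p y\<close> at \<open>- y\<close>, which forces
  \<open>f y \<ge> p y\<close>.\<close>

lemma real_hahn_banach:
  assumes p: "sublinear_on V p" and V: "cvs.subspace V" and y: "y \<in> V"
  shows "\<exists>f. (\<forall>a\<in>V. \<forall>b\<in>V. f (a + b) = f a + f b) \<and>
    (\<forall>t. \<forall>a\<in>V. f (complex_of_real t *\<^sub>C a) = t * f a) \<and> (\<forall>a\<in>V. f a \<le> p a) \<and> f y = p y"
proof -
  obtain f where f: "sublinear_on V f" "\<forall>x\<in>V. f x \<le> tilt p y x"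
    and min: "\<And>r. sublinear_on V r \<Longrightarrow> (\<forall>x\<in>V. r x \<le> f x) \<Longrightarrow> (\<forall>x\<in>V. r x = f x)"
    using exists_minimal_sublinear[OF sublinear_on_tilt[OF p V y] V] by blast
  have add: "f (a + b) = f a + f b" if "a \<in> V" "b \<in> V" for a b
    using minimal_sublinear_add[OF f(1) V min that] by blast
  have minus: "f (- a) = - f a" if "a \<in> V" for a
    using add[OF that cvs.subspace_neg[OF V that]] sublinear_on_zero[OF f(1) V] by simp
  have scale: "f (complex_of_real t *\<^sub>C a) = t * f a" if "a \<in> V" for t a
  proof (cases "0 \<le> t")
    case True
    then show ?thesis using sublinear_on_scale[OF f(1) V _ that] by blast
  next
    case False
    have "f (complex_of_real (- t) *\<^sub>C a) = - t * f a"
      using False sublinear_on_scale[OF f(1) V _ that, of "- t"] by simp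
    moreover have "f (- (complex_of_real t *\<^sub>C a)) = - f (complex_of_real t *\<^sub>C a)"
      using minus[OF cvs.subspace_scale[OF V that]] .
    ultimately show ?thesis by simp
  qed
  have le: "f a \<le> p a" if "a \<in> V" for a
    using f(2) tilt_le[OF p V that y, of 0] that by fastforce
  have "f (- y) \<le> tilt p y (- y)"
    using f(2) cvs.subspace_neg[OF V y] by blast
  also have "\<dots> \<le> - p y"
    using tilt_le[OF p V cvs.subspace_neg[OF V y] y, of 1] sublinear_on_zero[OF p V]
    by (simp add: scaleC_one)
  finally have "f y = p y" using minus[OF y] le[OF y] by simp
  then show ?thesis using add scale le by blast
qed

lemma complex_hahn_banach:
  assumes p: "seminorm_on V p" and V: "cvs.subspace V" and y: "y \<in> V"
  shows "\<exists>\<phi>\<in>lin_maps V UNIV. (\<forall>a\<in>V. cmod (\<phi> a) \<le> p a) \<and> Re (\<phi> y) = p y"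
proof -
  have "sublinear_on V p" using p unfolding seminorm_on_def sublinear_on_def by simp
  from real_hahn_banach[OF this V y] obtain f
    where add: "\<And>a b. a \<in> V \<Longrightarrow> b \<in> V \<Longrightarrow> f (a + b) = f a + f b"
      and scale: "\<And>t a. a \<in> V \<Longrightarrow> f (complex_of_real t *\<^sub>C a) = t * f a"
      and le: "\<And>a. a \<in> V \<Longrightarrow> f a \<le> p a" and fy: "f y = p y" by metis
  \<comment> \<open>With \<open>f\<close> as real part, complex linearity leaves no choice for the
    imaginary part.\<close>
  define \<phi> where "\<phi> = restr V (\<lambda>a. Complex (f a) (- f (\<i> *\<^sub>C a)))"
  have \<phi>: "\<phi> a = Complex (f a) (- f (\<i> *\<^sub>C a))" if "a \<in> V" for a
    using that by (simp add: \<phi>_def restr_def)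
  have V_scale: "c *\<^sub>C a \<in> V" if "a \<in> V" for c a using V that by (rule cvs.subspace_scale)
  have \<phi>_scale: "\<phi> (c *\<^sub>C a) = c * \<phi> a" if a: "a \<in> V" for c a
  proof -
    have ia: "\<i> *\<^sub>C a \<in> V" using a by (rule V_scale)
    have "c *\<^sub>C a = (complex_of_real (Re c) + complex_of_real (Im c) * \<i>) *\<^sub>C a"
      by (simp add: complex_eq mult.commute)
    also have "\<dots> = complex_of_real (Re c) *\<^sub>C a + complex_of_real (Im c) *\<^sub>C \<i> *\<^sub>C a"
      by (simp add: scaleC_add_left scaleC_scaleC)
    finally have c: "f (c *\<^sub>C a) = Re c * f a + Im c * f (\<i> *\<^sub>C a)"
      using add[OF V_scale[OF a] V_scale[OF ia]] scale[OF a] scale[OF ia] by simp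
    have "\<i> * c = complex_of_real (- Im c) + complex_of_real (Re c) * \<i>"
      by (simp add: complex_eq_iff)
    then have "\<i> *\<^sub>C c *\<^sub>C a = (complex_of_real (- Im c) + complex_of_real (Re c) * \<i>) *\<^sub>C a"
      by (simp add: scaleC_scaleC)
    also have "\<dots> = complex_of_real (- Im c) *\<^sub>C a + complex_of_real (Re c) *\<^sub>C \<i> *\<^sub>C a"
      by (simp only: scaleC_add_left scaleC_scaleC)
    finally have "f (\<i> *\<^sub>C c *\<^sub>C a) = - Im c * f a + Re c * f (\<i> *\<^sub>C a)"
      by (simp only: add[OF V_scale[OF a] V_scale[OF ia]] scale[OF a] scale[OF ia])
    then show ?thesis using c \<phi>[OF a] \<phi>[OF V_scale[OF a]] by (simp add: complex_eq_iff)
  qed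
  have "\<phi> \<in> lin_maps V UNIV"
    unfolding lin_maps_def
  proof (intro CollectI conjI ballI allI impI)
    fix a b assume ab: "a \<in> V" "b \<in> V"
    show "\<phi> (a + b) = \<phi> a + \<phi> b"
      using ab V by (simp add: \<phi> cvs.subspace_add scaleC_add_right add V_scale complex_eq_iff)
  next
    fix c a assume "a \<in> V"
    then show "\<phi> (c *\<^sub>C a) = c *\<^sub>C \<phi> a" by (simp add: \<phi>_scale scaleC_complex_def)
  qed (auto simp: \<phi>_def restr_def)
  moreover have "cmod (\<phi> a) \<le> p a" if a: "a \<in> V" for a
  proof (cases "\<phi> a = 0")
    case True
    then show ?thesis using p a by (simp add: seminorm_on_def)
  next
    case False
    \<comment> \<open>Rotating by this unimodular factor makes \<open>\<phi> (c *\<^sub>C a)\<close>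
      equal to \<open>cmod (\<phi> a)\<close>. It is real, hence a value of \<open>f\<close>, to
      which the one-sided bound applies.\<close>
    define c where "c = cnj (sgn (\<phi> a))"
    have c: "cmod c = 1" using False by (simp add: c_def norm_sgn)
    have "\<phi> (c *\<^sub>C a) = complex_of_real (cmod (\<phi> a))"
      using False unfolding \<phi>_scale[OF a] c_def sgn_eq
      by (simp add: complex_norm_square[symmetric] power2_eq_square mult.commute)
    then have "cmod (\<phi> a) = f (c *\<^sub>C a)" using \<phi>[OF V_scale[OF a]] by (simp add: complex_eq_iff)
    also have "\<dots> \<le> p (c *\<^sub>C a)" by (rule le[OF V_scale[OF a]])
    also have "\<dots> = p a" using p a c by (simp add: seminorm_on_def)
    finally show ?thesis .
  qed
  moreover have "Re (\<phi> y) = p y" using fy \<phi>[OF y] by simp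
  ultimately show ?thesis by blast
qed

text \<open>One continuous seminorm \<open>p\<close> does both jobs: it is positive at
  \<open>a - b\<close>, where the functional attains it, and it dominates the functional, which
  makes it continuous.\<close>

lemma dual_sp_separates:
  assumes "hlcs V T" and ab: "a \<in> V" "b \<in> V" "a \<noteq> b"
  shows "\<exists>\<phi>\<in>dual_sp V T. \<phi> a \<noteq> \<phi> b"
proof -
  obtain P where V: "cvs.subspace V" and P: "\<And>p. p \<in> P \<Longrightarrow> seminorm_on V p"
    and T: "T = seminorm_topology V P" and "Hausdorff_space T"
    using assms(1) unfolding hlcs_def locally_convex_def by blast
  then obtain p where p: "p \<in> P" "0 < p (a - b)"
    using hlcs_separating_seminorm[OF V P _ ab] by auto
  obtain \<phi> where \<phi>: "\<phi> \<in> lin_maps V UNIV" "\<And>a. a \<in> V \<Longrightarrow> cmod (\<phi> a) \<le> p a"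
      "Re (\<phi> (a - b)) = p (a - b)"
    using complex_hahn_banach[OF P[OF p(1)] V cvs.subspace_diff[OF V ab(1,2)]] by auto
  have diff: "\<phi> (c - d) = \<phi> c - \<phi> d" if "c \<in> V" "d \<in> V" for c d
  proof -
    have "\<phi> ((c - d) + d) = \<phi> (c - d) + \<phi> d"
      using \<phi>(1) cvs.subspace_diff[OF V that] that unfolding lin_maps_def by blast
    then show ?thesis by simp
  qed
  have "continuous_map T euclidean \<phi>"
    unfolding continuous_map_def
  proof (intro conjI allI impI)
    fix W :: "complex set" assume "openin euclidean W"
    then have W: "open W" by simp
    show "openin T {c \<in> topspace T. \<phi> c \<in> W}"
    proof (subst openin_subopen, intro ballI)
      fix c assume "c \<in> {c \<in> topspace T. \<phi> c \<in> W}"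
      then have c: "c \<in> V" "\<phi> c \<in> W" using T by auto
      then obtain e where e: "0 < e" "\<And>z. dist z (\<phi> c) < e \<Longrightarrow> z \<in> W"
        using W unfolding open_dist by blast
      have "\<phi> d \<in> W" if "d \<in> V" "p (d - c) < e" for d
        using e(2) \<phi>(2)[OF cvs.subspace_diff[OF V that(1) c(1)]] diff[OF that(1) c(1)] that(2)
        by (simp add: dist_norm)
      then have "{d \<in> V. p (d - c) < e} \<subseteq> {c \<in> topspace T. \<phi> c \<in> W}" using T by auto
      moreover have "openin T {d \<in> V. p (d - c) < e}"
        unfolding T using p(1) c(1) e(1) by (rule openin_seminorm_ball)
      moreover have "c \<in> {d \<in> V. p (d - c) < e}"
        using c e seminorm_on_zero[OF P[OF p(1)] V] by simp
      ultimately show "\<exists>U. openin T U \<and> c \<in> U \<and> U \<subseteq> {c \<in> topspace T. \<phi> c \<in> W}" by blast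
    qed
  qed auto
  then have "\<phi> \<in> dual_sp V T" using \<phi>(1) by (simp add: dual_sp_def)
  moreover have "\<phi> a \<noteq> \<phi> b" using diff[OF ab(1,2)] \<phi>(3) p(2) by auto
  ultimately show ?thesis by blast
qed

section \<open>Weak integrals and continuous linear maps\<close>

lemma is_weak_integral_unique:
  assumes "hlcs V TV" "is_weak_integral T \<mu> V TV F a" "is_weak_integral T \<mu> V TV F b"
  shows "a = b"
  using dual_sp_separates[OF assms(1), of a b] assms(2,3) unfolding is_weak_integral_def by metis

lemma weak_integral_eqI:
  "hlcs V TV \<Longrightarrow> is_weak_integral T \<mu> V TV F a \<Longrightarrow> weak_integral T \<mu> V TV F = a"
  unfolding weak_integral_def by (blast intro: is_weak_integral_unique)

lemma is_weak_integral_weak_integral: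
  "hlcs V TV \<Longrightarrow> F \<in> L1_sp T \<mu> V TV \<Longrightarrow> is_weak_integral T \<mu> V TV F (weak_integral T \<mu> V TV F)"
  by (auto simp: L1_sp_def weak_integral_eqI)

text \<open>Transposition: if \<open>\<phi>\<close> is in the dual of \<open>W\<close>, then
  \<open>\<phi>\<close> after \<open>k\<close> is in the dual of \<open>V\<close>, so the scalar
  conditions on the image of \<open>F\<close> are among those on \<open>F\<close>. The composite is
  cut off to vanish outside \<open>V\<close>, as members of \<open>dual_sp\<close> must.\<close>

lemma L1_sp_linear_image:
  assumes V: "hlcs V TV" and W: "hlcs W TW" and F: "F \<in> L1_sp T \<mu> V TV"
    and cont: "continuous_map TV TW k"
    and add: "\<And>a b. a \<in> V \<Longrightarrow> b \<in> V \<Longrightarrow> k (a + b) = k a + k b"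
    and scale: "\<And>c a. a \<in> V \<Longrightarrow> k (c *\<^sub>C a) = c *\<^sub>C k a"
  shows "(\<lambda>t. k (F t)) \<in> L1_sp T \<mu> W TW"
    and "weak_integral T \<mu> W TW (\<lambda>t. k (F t)) = k (weak_integral T \<mu> V TV F)"
proof -
  note subV = subspace_hlcs[OF V]
  have kW: "k a \<in> W" if "a \<in> V" for a
    using continuous_map_image_subset_topspace[OF cont] topspace_hlcs[OF V] topspace_hlcs[OF W] that
    by auto
  have k0: "k 0 = 0" using add[OF cvs.subspace_0 cvs.subspace_0, OF subV subV] by simp
  \<comment> \<open>This holds at every \<open>t\<close>, since \<open>F\<close> is zero outside the
    space; therefore the cutoff to \<open>V\<close> does not alter the scalar integrands.\<close>
  have FV: "F t \<in> V" for t
    using F cvs.subspace_0[OF subV] unfolding L1_sp_def prod_sp_def by (cases "t \<in> topspace T") auto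
  have dual: "restr V (\<lambda>a. \<phi> (k a)) \<in> dual_sp V TV" if \<phi>: "\<phi> \<in> dual_sp W TW" for \<phi>
  proof -
    have "continuous_map TV euclidean (\<phi> \<circ> k)"
      using cont \<phi> by (auto simp: dual_sp_def intro: continuous_map_compose)
    then have "continuous_map TV euclidean (restr V (\<lambda>a. \<phi> (k a)))"
      by (rule continuous_map_eq) (simp add: restr_def topspace_hlcs[OF V])
    moreover have "restr V (\<lambda>a. \<phi> (k a)) \<in> lin_maps V UNIV"
      using \<phi> subV
      by (simp add: dual_sp_def lin_maps_def restr_def kW add scale cvs.subspace_add
          cvs.subspace_scale)
    ultimately show ?thesis by (simp add: dual_sp_def)
  qed
  have restr_F: "(\<lambda>t. restr V (\<lambda>a. \<phi> (k a)) (F t)) = (\<lambda>t. \<phi> (k (F t)))" for \<phi> :: "_ \<Rightarrow> complex"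
    by (simp add: restr_def FV)
  have int: "is_weak_integral T \<mu> W TW (\<lambda>t. k (F t)) (k a)" if a: "is_weak_integral T \<mu> V TV F a" for a
    unfolding is_weak_integral_def
  proof (intro conjI ballI)
    have aV: "a \<in> V" using a by (simp add: is_weak_integral_def)
    then show "k a \<in> W" by (rule kW)
    fix \<phi> assume "\<phi> \<in> dual_sp W TW"
    from dual[OF this] a show "\<phi> (k a) = ess_integral T \<mu> (\<lambda>t. \<phi> (k (F t)))"
      unfolding is_weak_integral_def using restr_F[of \<phi>] aV by (fastforce simp: restr_def)
  qed
  show "weak_integral T \<mu> W TW (\<lambda>t. k (F t)) = k (weak_integral T \<mu> V TV F)"
    using int[OF is_weak_integral_weak_integral[OF V F]] by (rule weak_integral_eqI[OF W])
  have "ess_integrable T \<mu> (\<lambda>t. \<phi> (k (F t)))" if "\<phi> \<in> dual_sp W TW" for \<phi>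
    using dual[OF that] F restr_F[of \<phi>] unfolding L1_sp_def by fastforce
  moreover have "(\<lambda>t. k (F t)) \<in> prod_sp (topspace T) (\<lambda>_. W)"
    using F by (auto simp: L1_sp_def prod_sp_def kW k0)
  ultimately show "(\<lambda>t. k (F t)) \<in> L1_sp T \<mu> W TW"
    using F int unfolding L1_sp_def by blast
qed

section \<open>The finest locally convex topology\<close>

text \<open>These are the seminorms whose pullbacks are continuous. The condition uses differences
  of images, not images of differences, so it asks for no linear structure on the source
  spaces.\<close>

definition final_seminorms ::
  "'b::cvec set \<Rightarrow> 'x set \<Rightarrow> ('x \<Rightarrow> 'a topology) \<Rightarrow> ('x \<Rightarrow> 'a \<Rightarrow> 'b) \<Rightarrow> ('b \<Rightarrow> real) set" where
  "final_seminorms V X S h = {p. seminorm_on V p \<and>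
     (\<forall>x\<in>X. \<forall>f0\<in>topspace (S x). \<forall>e>0.
        openin (S x) {f \<in> topspace (S x). p (h x f - h x f0) < e})}"

text \<open>Continuity of the maps \<open>h x\<close> into any competing topology says precisely
  that its generating seminorms belong to \<open>final_seminorms\<close>; monotonicity does the
  rest.\<close>

lemma is_finest_lc_final_seminorms:
  assumes V: "cvs.subspace V" and h: "\<And>x f. x \<in> X \<Longrightarrow> f \<in> topspace (S x) \<Longrightarrow> h x f \<in> V"
  shows "is_finest_lc V X S h (seminorm_topology V (final_seminorms V X S h))"
  unfolding is_finest_lc_def
proof (intro conjI allI impI ballI)
  have sn: "seminorm_on V p" if "p \<in> final_seminorms V X S h" for p
    using that by (simp add: final_seminorms_def)
  then show "locally_convex V (seminorm_topology V (final_seminorms V X S h))"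
    using V unfolding locally_convex_def by blast
  fix x assume x: "x \<in> X"
  show "continuous_map (S x) (seminorm_topology V (final_seminorms V X S h)) (h x)"
  proof (rule continuous_map_seminorm_topologyI[OF V sn h[OF x]])
    fix p f0 and e :: real
    assume *: "p \<in> final_seminorms V X S h" "f0 \<in> topspace (S x)" "0 < e"
    then have "openin (S x) {f \<in> topspace (S x). p (h x f - h x f0) < e}"
      using x by (simp add: final_seminorms_def)
    moreover have "f0 \<in> {f \<in> topspace (S x). p (h x f - h x f0) < e}"
      using * seminorm_on_zero[OF sn[OF *(1)] V] by simp
    ultimately show "\<exists>U. openin (S x) U \<and> f0 \<in> U \<and> (\<forall>f\<in>U. p (h x f - h x f0) < e)" by blast
  qed auto
next
  fix T' U
  assume T': "locally_convex V T' \<and> (\<forall>x\<in>X. continuous_map (S x) T' (h x))" and U: "openin T' U"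
  then obtain P where P: "\<And>p. p \<in> P \<Longrightarrow> seminorm_on V p" "T' = seminorm_topology V P"
    unfolding locally_convex_def by blast
  then have "\<forall>x\<in>X. continuous_map (S x) (seminorm_topology V P) (h x)" using T' by blast
  then have "P \<subseteq> final_seminorms V X S h"
    using P(1) h unfolding final_seminorms_def continuous_map_seminorm_topology_iff by auto
  then show "openin (seminorm_topology V (final_seminorms V X S h)) U"
    using U P(2) seminorm_topology_mono by blast
qed

lemma finest_lc_topology_eq:
  assumes "cvs.subspace V" and "\<And>x f. x \<in> X \<Longrightarrow> f \<in> topspace (S x) \<Longrightarrow> h x f \<in> V"
  shows "finest_lc_topology V X S h = seminorm_topology V (final_seminorms V X S h)"
  unfolding finest_lc_topology_def
proof (rule the_equality)
  show *: "is_finest_lc V X S h (seminorm_topology V (final_seminorms V X S h))"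
    using assms by (rule is_finest_lc_final_seminorms)
  show "T = seminorm_topology V (final_seminorms V X S h)" if "is_finest_lc V X S h T" for T
    using that * unfolding is_finest_lc_def topology_eq by blast
qed

section \<open>The space of diagonal operators\<close>

definition coord :: "('x \<Rightarrow> 'e::cvec set) \<Rightarrow> 'x \<Rightarrow> (('x \<Rightarrow> 'e) \<Rightarrow> 'x \<Rightarrow> 'e) \<Rightarrow> 'e \<Rightarrow> 'e" where
  "coord E x g = restr (E x) (\<lambda>z. g (iota x z) x)"

lemma coord_add: "coord E x (g + g') = coord E x g + coord E x g'"
  by (rule ext) (simp add: coord_def restr_def)

lemma coord_diff: "coord E x (g - g') = coord E x g - coord E x g'"
  by (rule ext) (simp add: coord_def restr_def)

lemma coord_scale: "coord E x (c *\<^sub>C g) = c *\<^sub>C coord E x g"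
  by (rule ext) (simp add: coord_def restr_def scaleC_fun_def)

lemma coord_zero: "coord E x 0 = 0"
  by (rule ext) (simp add: coord_def restr_def)

lemma Psi_eq_coord: "x \<in> X \<Longrightarrow> s \<in> topspace T \<Longrightarrow> Psi X E T F x s = coord E x (F s)"
  by (simp add: Psi_def coord_def restr_def)

lemma Psi_eq_coord_on_prod_sp:
  assumes "x \<in> X" "F \<in> prod_sp (topspace T) V"
  shows "Psi X E T F x = (\<lambda>s. coord E x (F s))"
proof
  fix s show "Psi X E T F x s = coord E x (F s)"
    using assms by (cases "s \<in> topspace T") (auto simp: Psi_def coord_def restr_def prod_sp_def)
qed

lemma scaleC_fun_apply: "(c *\<^sub>C f) x = c *\<^sub>C f x"
  by (simp add: scaleC_fun_def)

lemma iota_add: "iota x (a + b) = iota x a + iota x (b::'a::cvec)"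
  by (rule ext) (simp add: iota_def)

lemma iota_scale: "iota x (c *\<^sub>C a) = c *\<^sub>C iota x (a::'a::cvec)"
  by (rule ext) (simp add: iota_def scaleC_fun_def)

section \<open>Diagonal operators and their coordinates\<close>

context consistent_data
begin

lemma G_sp_apply: "v \<in> H \<Longrightarrow> restr H (theta X E u) v y = u y (v y)"
  using H_subset by (auto simp: restr_def theta_def)

lemma A_cont_End: "u \<in> A \<Longrightarrow> x \<in> X \<Longrightarrow> u x \<in> cont_End (E x) (TE x)"
  using A_subset by (auto simp: prod_sp_def)

text \<open>The family \<open>u\<close> is recovered from its operator by probing with vectors
  concentrated in one coordinate. They are available because \<open>H\<close> contains all
  \<open>iota x z\<close> with \<open>z\<close> in \<open>E x\<close>.\<close>

lemma coord_theta:
  assumes "u \<in> A" "x \<in> X"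
  shows "coord E x (restr H (theta X E u)) = u x"
proof
  fix z show "coord E x (restr H (theta X E u)) z = u x z"
  proof (cases "z \<in> E x")
    case True
    then have "iota x z \<in> H" using iota_in_H assms(2) by blast
    then show ?thesis using True by (simp add: coord_def restr_def[of "E x"] G_sp_apply) (simp add: iota_def)
  next
    case False
    then show ?thesis
      using A_cont_End[OF assms] by (simp add: coord_def restr_def cont_End_def End_sp_def lin_maps_def)
  qed
qed

lemma coord_cont_End: "g \<in> G_sp X E H A \<Longrightarrow> x \<in> X \<Longrightarrow> coord E x g \<in> cont_End (E x) (TE x)"
  by (auto simp: G_sp_def coord_theta A_cont_End)

text \<open>Here diagonality enters: component \<open>x\<close> of \<open>g v\<close> depends on
  \<open>v x\<close> alone, so replacing \<open>v\<close> by \<open>iota x (v x)\<close> loses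
  nothing.\<close>

lemma coord_apply: "g \<in> G_sp X E H A \<Longrightarrow> x \<in> X \<Longrightarrow> v \<in> H \<Longrightarrow> coord E x g (v x) = g v x"
  by (auto simp: G_sp_def coord_theta G_sp_apply)

lemma G_sp_eqI:
  assumes "g \<in> G_sp X E H A" "g' \<in> G_sp X E H A" "\<And>x. x \<in> X \<Longrightarrow> coord E x g = coord E x g'"
  shows "g = g'"
proof -
  obtain u u' where u: "u \<in> A" "g = restr H (theta X E u)"
    and u': "u' \<in> A" "g' = restr H (theta X E u')"
    using assms(1,2) by (auto simp: G_sp_def)
  have "u x = u' x" for x
  proof (cases "x \<in> X")
    case True
    then show ?thesis using assms(3)[OF True] u u' by (simp add: coord_theta)
  next
    case False
    then have "u x = 0" "u' x = 0" using u(1) u'(1) A_subset by (auto simp: prod_sp_def)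
    then show ?thesis by simp
  qed
  then show ?thesis using u u' by (metis ext)
qed

lemma subspace_G_sp: "cvs.subspace (G_sp X E H A)"
proof (rule cvs.subspaceI)
  let ?\<theta> = "\<lambda>u. restr H (theta X E u)"
  have "?\<theta> 0 = 0" by (intro ext) (simp add: restr_def theta_def)
  then show "0 \<in> G_sp X E H A"
    using cvs.subspace_0[OF A_subspace] unfolding G_sp_def by force
  have add: "?\<theta> (u + u') = ?\<theta> u + ?\<theta> u'" for u u'
    by (intro ext) (simp add: restr_def theta_def)
  show "g + g' \<in> G_sp X E H A" if g: "g \<in> G_sp X E H A" "g' \<in> G_sp X E H A" for g g'
  proof -
    obtain u u' where "u \<in> A" "u' \<in> A" "g = ?\<theta> u" "g' = ?\<theta> u'"
      using g by (auto simp: G_sp_def)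
    then show ?thesis
      using cvs.subspace_add[OF A_subspace, of u u'] add[of u u'] unfolding G_sp_def by force
  qed
  have scale: "?\<theta> (c *\<^sub>C u) = c *\<^sub>C ?\<theta> u" for c u
    by (intro ext) (simp add: restr_def theta_def scaleC_fun_def)
  show "c *\<^sub>C g \<in> G_sp X E H A" if g: "g \<in> G_sp X E H A" for c g
  proof -
    obtain u where "u \<in> A" "g = ?\<theta> u" using g by (auto simp: G_sp_def)
    then show ?thesis
      using cvs.subspace_scale[OF A_subspace, of u c] scale[of c u] unfolding G_sp_def by force
  qed
qed

text \<open>The operator comes from the family concentrated at \<open>x\<close>. Such families lie
  in \<open>A\<close> when \<open>f\<close> is continuous, so \<open>h_map H x\<close> takes values
  in \<open>G\<close>.\<close>

lemma h_map_eq_theta: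
  assumes "x \<in> X"
  shows "h_map H x f = restr H (theta X E (iota x f))"
proof (intro ext)
  fix v y show "h_map H x f v y = restr H (theta X E (iota x f)) v y"
    using H_subset by (cases "v \<in> H") (auto simp: h_map_def restr_def theta_def iota_def)
qed

lemma h_map_in_G_sp: "x \<in> X \<Longrightarrow> f \<in> cont_End (E x) (TE x) \<Longrightarrow> h_map H x f \<in> G_sp X E H A"
  using iota_in_A by (force simp: h_map_eq_theta G_sp_def)

lemma coord_h_map:
  assumes "x \<in> X" "y \<in> X" "f \<in> cont_End (E y) (TE y)"
  shows "coord E x (h_map H y f) = (if x = y then f else 0)"
proof -
  have "iota y f \<in> A" using assms iota_in_A by blast
  then show ?thesis using assms by (auto simp: h_map_eq_theta coord_theta iota_def zero_fun_def)
qed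

section \<open>The final topology on the space of diagonal operators\<close>

lemma topspace_tau: "x \<in> X \<Longrightarrow> topspace (tau x) = cont_End (E x) (TE x)"
  by (rule topspace_hlcs[OF tau_hlcs])

lemma G_top_eq:
  "G_top X E tau H A = seminorm_topology (G_sp X E H A)
     (final_seminorms (G_sp X E H A) X tau (h_map H))"
  unfolding G_top_def
  by (rule finest_lc_topology_eq[OF subspace_G_sp]) (simp add: topspace_tau h_map_in_G_sp)

text \<open>For \<open>y = x\<close> the set to be open is a \<open>q\<close>-ball of
  \<open>tau x\<close>; for \<open>y \<noteq> x\<close> the coordinate of the difference is zero and
  the set is the whole space.\<close>

lemma seminorm_coord_final:
  assumes x: "x \<in> X" and Q: "\<And>q. q \<in> Q \<Longrightarrow> seminorm_on (cont_End (E x) (TE x)) q"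
    and tau_Q: "tau x = seminorm_topology (cont_End (E x) (TE x)) Q" and q: "q \<in> Q"
  shows "(\<lambda>g. q (coord E x g)) \<in> final_seminorms (G_sp X E H A) X tau (h_map H)"
  unfolding final_seminorms_def
proof (intro CollectI conjI ballI allI impI)
  show "seminorm_on (G_sp X E H A) (\<lambda>g. q (coord E x g))"
    using Q[OF q] coord_cont_End[OF _ x] unfolding seminorm_on_def by (simp add: coord_add coord_scale)
  fix y f0 and e :: real assume y: "y \<in> X" and f0: "f0 \<in> topspace (tau y)" and e: "0 < e"
  show "openin (tau y) {f \<in> topspace (tau y). q (coord E x (h_map H y f - h_map H y f0)) < e}"
  proof (cases "x = y")
    case True
    then have "{f \<in> topspace (tau y). q (coord E x (h_map H y f - h_map H y f0)) < e}
        = {f \<in> cont_End (E x) (TE x). q (f - f0) < e}"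
      using f0 y by (auto simp: coord_diff coord_h_map topspace_tau)
    moreover have "openin (tau x) {f \<in> cont_End (E x) (TE x). q (f - f0) < e}"
      unfolding tau_Q using q f0 e topspace_tau[OF y] True by (intro openin_seminorm_ball) auto
    ultimately show ?thesis using True by simp
  next
    case False
    then have "{f \<in> topspace (tau y). q (coord E x (h_map H y f - h_map H y f0)) < e}
        = topspace (tau y)"
      using f0 x y e seminorm_on_zero[OF Q[OF q] subspace_hlcs[OF tau_hlcs[OF x]]]
      by (auto simp: coord_diff coord_h_map topspace_tau)
    then show ?thesis by simp
  qed
qed

lemma continuous_map_coord:
  assumes x: "x \<in> X"
  shows "continuous_map (G_top X E tau H A) (tau x) (coord E x)"
proof -
  obtain Q where Q: "\<And>q. q \<in> Q \<Longrightarrow> seminorm_on (cont_End (E x) (TE x)) q"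
    and tau_Q: "tau x = seminorm_topology (cont_End (E x) (TE x)) Q"
    using tau_hlcs[OF x] unfolding hlcs_def locally_convex_def by blast
  show ?thesis
    unfolding tau_Q
  proof (rule continuous_map_seminorm_topologyI[OF subspace_hlcs[OF tau_hlcs[OF x]] Q])
    show "coord E x g \<in> cont_End (E x) (TE x)" if "g \<in> topspace (G_top X E tau H A)" for g
      using that x by (simp add: G_top_eq coord_cont_End)
    fix q g0 and e :: real
    assume q: "q \<in> Q" and g0: "g0 \<in> topspace (G_top X E tau H A)" and e: "0 < e"
    let ?U = "{g \<in> G_sp X E H A. q (coord E x (g - g0)) < e}"
    have g0: "g0 \<in> G_sp X E H A" using g0 by (simp add: G_top_eq)
    then have "openin (G_top X E tau H A) ?U"
      unfolding G_top_eq
      using openin_seminorm_ball[OF seminorm_coord_final[OF x Q tau_Q q] g0 e] by simp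
    moreover have "g0 \<in> ?U"
      using g0 e seminorm_on_zero[OF Q[OF q] subspace_hlcs[OF tau_hlcs[OF x]]]
      by (simp add: coord_zero)
    ultimately show "\<exists>U. openin (G_top X E tau H A) U \<and> g0 \<in> U \<and>
        (\<forall>g\<in>U. q (coord E x g - coord E x g0) < e)"
      by (auto simp: coord_diff)
  qed
qed

lemma hlcs_G: "hlcs (G_sp X E H A) (G_top X E tau H A)"
  unfolding hlcs_def
proof
  show "locally_convex (G_sp X E H A) (G_top X E tau H A)"
    using is_finest_lc_final_seminorms[OF subspace_G_sp, of X tau "h_map H"]
    by (simp add: G_top_eq is_finest_lc_def topspace_tau h_map_in_G_sp)
  show "Hausdorff_space (G_top X E tau H A)"
    unfolding Hausdorff_space_def
  proof (intro allI impI)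
    fix g g' assume *: "g \<in> topspace (G_top X E tau H A) \<and> g' \<in> topspace (G_top X E tau H A) \<and> g \<noteq> g'"
    then have g: "g \<in> G_sp X E H A" "g' \<in> G_sp X E H A" by (auto simp: G_top_eq)
    then obtain x where x: "x \<in> X" "coord E x g \<noteq> coord E x g'"
      using G_sp_eqI * by blast
    have "Hausdorff_space (tau x)" using tau_hlcs[OF x(1)] by (simp add: hlcs_def)
    then obtain U W where UW: "openin (tau x) U" "openin (tau x) W" "coord E x g \<in> U"
        "coord E x g' \<in> W" "disjnt U W"
      using x g coord_cont_End topspace_tau[OF x(1)] unfolding Hausdorff_space_def by metis
    let ?pre = "\<lambda>U. {g \<in> topspace (G_top X E tau H A). coord E x g \<in> U}"
    have "openin (G_top X E tau H A) (?pre U)" "openin (G_top X E tau H A) (?pre W)"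
      using continuous_map_coord[OF x(1)] UW(1,2) by (auto intro: openin_continuous_map_preimage)
    moreover have "g \<in> ?pre U" "g' \<in> ?pre W" "disjnt (?pre U) (?pre W)"
      using * UW by (auto simp: disjnt_def)
    ultimately show "\<exists>U V. openin (G_top X E tau H A) U \<and> openin (G_top X E tau H A) V \<and>
        g \<in> U \<and> g' \<in> V \<and> disjnt U V" by blast
  qed
qed

section \<open>The map \<open>Psi\<close> and the U-space property\<close>

lemma Psi_linear:
  "restr (prod_sp (topspace T) (\<lambda>_. End_sp H)) (Psi X E T)
     \<in> lin_maps (prod_sp (topspace T) (\<lambda>_. End_sp H))
         (prod_sp X (\<lambda>x. prod_sp (topspace T) (\<lambda>_. End_sp (E x))))"
proof -
  let ?M = "prod_sp (topspace T) (\<lambda>_. End_sp H)"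
  have H: "cvs.subspace H" by (rule subspace_hlcs[OF H_hlcs])
  have M_add: "F + F' \<in> ?M" if "F \<in> ?M" "F' \<in> ?M" for F F'
    using that cvs.subspace_add[OF H]
    by (simp add: prod_sp_def End_sp_def lin_maps_def algebra_simps scaleC_add_right)
  have M_scale: "c *\<^sub>C F \<in> ?M" if "F \<in> ?M" for c F
    using that cvs.subspace_scale[OF H]
    by (simp add: prod_sp_def End_sp_def lin_maps_def scaleC_fun_apply scaleC_add_right
        scaleC_scaleC mult.commute)
  have End: "coord E x f \<in> End_sp (E x)" if f: "f \<in> End_sp H" and x: "x \<in> X" for f x
  proof -
    have i: "iota x z \<in> H" if "z \<in> E x" for z using iota_in_H[OF x] that by blast
    have E: "cvs.subspace (E x)" by (rule subspace_hlcs[OF E_hlcs[OF x]])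
    have "f (iota x z) x \<in> E x" if "z \<in> E x" for z
    proof -
      have "f (iota x z) \<in> H" using f i[OF that] by (simp add: End_sp_def lin_maps_def)
      then show ?thesis using H_subset x by (auto simp: prod_sp_def)
    qed
    then show ?thesis
      using f i cvs.subspace_add[OF E] cvs.subspace_scale[OF E]
      by (simp add: End_sp_def lin_maps_def coord_def restr_def iota_add iota_scale)
        (simp add: scaleC_fun_def)
  qed
  have Psi_M: "Psi X E T F \<in> prod_sp X (\<lambda>x. prod_sp (topspace T) (\<lambda>_. End_sp (E x)))"
    if "F \<in> ?M" for F
  proof -
    have "coord E x (F s) \<in> End_sp (E x)" if "x \<in> X" "s \<in> topspace T" for x s
      using End[OF _ that(1)] \<open>F \<in> ?M\<close> that(2) by (auto simp: prod_sp_def)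
    then have "Psi X E T F x s \<in> End_sp (E x)" if "x \<in> X" "s \<in> topspace T" for x s
      using that by (simp add: Psi_eq_coord)
    moreover have "Psi X E T F x s = 0" if "s \<notin> topspace T" for x s
      using that by (simp add: Psi_def restr_def)
    moreover have "Psi X E T F x = 0" if "x \<notin> X" for x
      using that by (simp add: Psi_def restr_def)
    ultimately show ?thesis by (simp add: prod_sp_def)
  qed
  have "Psi X E T (F + F') = Psi X E T F + Psi X E T F'" for F F'
    by (intro ext) (simp add: Psi_def restr_def)
  moreover have "Psi X E T (c *\<^sub>C F) = c *\<^sub>C Psi X E T F" for c F
    by (intro ext) (simp add: Psi_def restr_def scaleC_fun_def)
  ultimately show ?thesis
    unfolding lin_maps_def using M_add M_scale Psi_M by (simp add: restr_def)
qed

lemma G_sp_subset_cont_End: "G_sp X E H A \<subseteq> cont_End H TH"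
  using A_theta by (auto simp: G_sp_def)

text \<open>On such \<open>F\<close> the map \<open>Psi\<close> acts pointwise by the continuous
  linear map \<open>coord E x\<close>, so this is an instance of the transport of weak
  integrals.\<close>

lemma Psi_L1:
  assumes F: "F \<in> L1_sp T \<nu> (G_sp X E H A) (G_top X E tau H A)" and x: "x \<in> X"
  shows "Psi X E T F x \<in> L1_sp T \<nu> (cont_End (E x) (TE x)) (tau x)"
    and "weak_integral T \<nu> (cont_End (E x) (TE x)) (tau x) (Psi X E T F x)
      = coord E x (weak_integral T \<nu> (G_sp X E H A) (G_top X E tau H A) F)"
proof -
  have Psi: "Psi X E T F x = (\<lambda>s. coord E x (F s))"
    using F by (intro Psi_eq_coord_on_prod_sp[OF x]) (auto simp: L1_sp_def)
  note * = L1_sp_linear_image[OF hlcs_G tau_hlcs[OF x] F continuous_map_coord[OF x]]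
  show "Psi X E T F x \<in> L1_sp T \<nu> (cont_End (E x) (TE x)) (tau x)"
    unfolding Psi by (rule *) (simp_all add: coord_add coord_scale)
  show "weak_integral T \<nu> (cont_End (E x) (TE x)) (tau x) (Psi X E T F x)
      = coord E x (weak_integral T \<nu> (G_sp X E H A) (G_top X E tau H A) F)"
    unfolding Psi by (rule *) (simp_all add: coord_add coord_scale)
qed

lemma weak_integral_in_G:
  "F \<in> L1_sp T \<nu> (G_sp X E H A) (G_top X E tau H A) \<Longrightarrow>
     weak_integral T \<nu> (G_sp X E H A) (G_top X E tau H A) F \<in> G_sp X E H A"
  using is_weak_integral_weak_integral[OF hlcs_G] by (auto simp: is_weak_integral_def)

lemma U_space_G:
  assumes "D \<subseteq> H"
  shows "U_space TYPE('t) X E TE tau H TH D (G_sp X E H A) (G_top X E tau H A)"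
  unfolding U_space_def
proof (intro conjI allI impI)
  fix T :: "'t topology"
  let ?M = "prod_sp (topspace T) (\<lambda>_. End_sp H)"
  have "F \<in> ?M" if "F \<in> L1_sp T \<nu> (G_sp X E H A) (G_top X E tau H A)" for F \<nu>
    using that G_sp_subset_cont_End by (auto simp: L1_sp_def prod_sp_def cont_End_def)
  \<comment> \<open>Membership in \<open>lin_maps\<close> requires the cut-off version of
    \<open>Psi\<close>; maps with values in \<open>G\<close> lie in the domain, where the cutoff has
    no effect.\<close>
  then have Psi: "restr ?M (Psi X E T) F = Psi X E T F"
    if "F \<in> L1_sp T \<nu> (G_sp X E H A) (G_top X E tau H A)" for F \<nu>
    using that by (auto simp: restr_def)
  show "\<exists>\<Psi>\<in>lin_maps ?M (prod_sp X (\<lambda>x. prod_sp (topspace T) (\<lambda>_. End_sp (E x)))).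
      \<forall>\<nu>. radon_measure T \<nu> \<longrightarrow>
        \<Psi> ` L1_sp T \<nu> (G_sp X E H A) (G_top X E tau H A)
          \<subseteq> prod_sp X (\<lambda>x. L1_sp T \<nu> (cont_End (E x) (TE x)) (tau x)) \<and>
        (\<forall>F\<in>L1_sp T \<nu> (G_sp X E H A) (G_top X E tau H A). \<forall>v\<in>D. \<forall>x\<in>X.
          weak_integral T \<nu> (cont_End (E x) (TE x)) (tau x) (\<Psi> F x) (v x)
            = weak_integral T \<nu> (G_sp X E H A) (G_top X E tau H A) F v x)"
  \<comment> \<open>The witness is built without any reference to a measure, so it may be chosen
    before \<open>\<nu>\<close>.\<close>
  proof (intro bexI[OF _ Psi_linear] allI impI conjI ballI)
    fix \<nu>
    show "restr ?M (Psi X E T) ` L1_sp T \<nu> (G_sp X E H A) (G_top X E tau H A)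
        \<subseteq> prod_sp X (\<lambda>x. L1_sp T \<nu> (cont_End (E x) (TE x)) (tau x))"
    proof (rule image_subsetI)
      fix F assume F: "F \<in> L1_sp T \<nu> (G_sp X E H A) (G_top X E tau H A)"
      have "Psi X E T F \<in> prod_sp X (\<lambda>x. L1_sp T \<nu> (cont_End (E x) (TE x)) (tau x))"
        using Psi_L1(1)[OF F] by (simp add: prod_sp_def) (simp add: Psi_def restr_def)
      then show "restr ?M (Psi X E T) F
          \<in> prod_sp X (\<lambda>x. L1_sp T \<nu> (cont_End (E x) (TE x)) (tau x))"
        unfolding Psi[OF F] .
    qed
    fix F v x
    assume F: "F \<in> L1_sp T \<nu> (G_sp X E H A) (G_top X E tau H A)" and v: "v \<in> D" and x: "x \<in> X"
    have "v \<in> H" using v assms by blast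
    then show "weak_integral T \<nu> (cont_End (E x) (TE x)) (tau x) (restr ?M (Psi X E T) F x) (v x)
        = weak_integral T \<nu> (G_sp X E H A) (G_top X E tau H A) F v x"
      unfolding Psi[OF F] Psi_L1(2)[OF F x] by (rule coord_apply[OF weak_integral_in_G[OF F] x])
  qed
qed (use assms hlcs_G G_sp_subset_cont_End in auto)

text \<open>The integral is carried along two arrows: the coordinate map into the endomorphisms of
  \<open>E x\<close>, then evaluation at \<open>v x\<close>.\<close>

lemma weak_integral_Psi_apply:
  assumes F: "F \<in> L1_sp T \<nu> (G_sp X E H A) (G_top X E tau H A)" and x: "x \<in> X" and v: "v \<in> H"
    and cont: "continuous_map (tau x) (TE x) (\<lambda>f. f (v x))"
  shows "(\<lambda>s. Psi X E T F x s (v x)) \<in> L1_sp T \<nu> (E x) (TE x)"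
    and "weak_integral T \<nu> (E x) (TE x) (\<lambda>s. Psi X E T F x s (v x))
      = weak_integral T \<nu> (G_sp X E H A) (G_top X E tau H A) F v x"
proof -
  note * = L1_sp_linear_image[OF tau_hlcs[OF x] E_hlcs[OF x] Psi_L1(1)[OF F x] cont]
  show "(\<lambda>s. Psi X E T F x s (v x)) \<in> L1_sp T \<nu> (E x) (TE x)"
    by (rule *) (simp_all add: scaleC_fun_def)
  have "weak_integral T \<nu> (E x) (TE x) (\<lambda>s. Psi X E T F x s (v x))
      = weak_integral T \<nu> (cont_End (E x) (TE x)) (tau x) (Psi X E T F x) (v x)"
    by (rule *) (simp_all add: scaleC_fun_def)
  then show "weak_integral T \<nu> (E x) (TE x) (\<lambda>s. Psi X E T F x s (v x))
      = weak_integral T \<nu> (G_sp X E H A) (G_top X E tau H A) F v x"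
    using Psi_L1(2)[OF F x] coord_apply[OF weak_integral_in_G[OF F] x v] by simp
qed

section \<open>Evaluation at points of the bounded sets\<close>

text \<open>The preimage under \<open>f\<close> of the open unit ball of \<open>nu x j\<close> is a
  neighbourhood of 0, so a multiple \<open>r\<close> of it absorbs \<open>B\<close>, and
  \<open>r\<close> is the bound. Without a bound the real supremum in \<open>sup_seminorm\<close>
  would not dominate its terms.\<close>

lemma bdd_above_seminorm_image:
  assumes x: "x \<in> X" and j: "j \<in> J x" and B: "vn_bounded (E x) (TE x) B"
    and f: "f \<in> cont_End (E x) (TE x)"
  shows "bdd_above ((\<lambda>w. nu x j (f w)) ` B)"
proof -
  have E: "cvs.subspace (E x)" by (rule subspace_hlcs[OF E_hlcs[OF x]])
  have fE: "f a \<in> E x" "f (c *\<^sub>C a) = c *\<^sub>C f a" if "a \<in> E x" for a c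
    using f that by (auto simp: cont_End_def End_sp_def lin_maps_def)
  have f0: "f 0 = 0" using fE(2)[OF cvs.subspace_0[OF E], of 0] by simp
  let ?U = "{a \<in> E x. nu x j (f a) < 1}"
  have "continuous_map (TE x) (seminorm_topology (E x) (nu x ` J x)) f"
    using f nu_fundamental[OF x] by (simp add: cont_End_def)
  then have "\<forall>a\<in>E x. \<forall>e>0. openin (TE x) {t \<in> topspace (TE x). nu x j (f t - a) < e}"
    using j unfolding continuous_map_seminorm_topology_iff by blast
  from this[rule_format, OF cvs.subspace_0[OF E], of 1] have "openin (TE x) ?U"
    using topspace_hlcs[OF E_hlcs[OF x]] by simp
  moreover have "0 \<in> ?U"
    using seminorm_on_zero[OF nu_seminorm[OF x j] E] f0 cvs.subspace_0[OF E] by simp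
  ultimately obtain r where r: "0 < r" "\<And>c. r \<le> cmod c \<Longrightarrow> B \<subseteq> (\<lambda>a. c *\<^sub>C a) ` ?U"
    using B unfolding vn_bounded_def by blast
  have "nu x j (f w) \<le> r" if w: "w \<in> B" for w
  proof -
    obtain a where a: "w = complex_of_real r *\<^sub>C a" "a \<in> E x" "nu x j (f a) < 1"
      using r(2)[of "complex_of_real r"] r(1) w by auto
    have "nu x j (f w) = r * nu x j (f a)"
      using a fE r(1) nu_seminorm[OF x j] by (simp add: seminorm_on_def)
    also have "\<dots> \<le> r * 1" using a(3) r(1) by (intro mult_left_mono) auto
    finally show ?thesis by simp
  qed
  then show ?thesis by (rule bdd_aboveI2)
qed

text \<open>As \<open>w\<close> is one of the points over which the supremum is taken,
  \<open>nu x j (f w)\<close> is at most the seminorm of \<open>f\<close> for the pair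
  \<open>l\<close>, \<open>j\<close>.\<close>

lemma continuous_map_evaluation:
  assumes x: "x \<in> X" and tau: "tau x = S_topology (E x) (TE x) (J x) (nu x) L B"
    and l: "l \<in> L" and B: "vn_bounded (E x) (TE x) (B l)" and w: "w \<in> B l"
  shows "continuous_map (tau x) (TE x) (\<lambda>f. f w)"
proof -
  have E: "cvs.subspace (E x)" by (rule subspace_hlcs[OF E_hlcs[OF x]])
  have L: "cvs.subspace (cont_End (E x) (TE x))" by (rule subspace_hlcs[OF tau_hlcs[OF x]])
  have wE: "w \<in> E x" using B w by (auto simp: vn_bounded_def)
  have le: "nu x j (f w) \<le> sup_seminorm (B l) (nu x j) f"
    if "j \<in> J x" "f \<in> cont_End (E x) (TE x)" for j f
    unfolding sup_seminorm_def
    using bdd_above_seminorm_image[OF x that(1) B that(2)] w by (intro cSup_upper) auto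
  have "continuous_map (tau x) (seminorm_topology (E x) (nu x ` J x)) (\<lambda>f. f w)"
  proof (rule continuous_map_seminorm_topologyI[OF E])
    show "seminorm_on (E x) p" if "p \<in> nu x ` J x" for p using that nu_seminorm[OF x] by blast
    show "f w \<in> E x" if "f \<in> topspace (tau x)" for f
      using that wE topspace_tau[OF x] by (auto simp: cont_End_def End_sp_def lin_maps_def)
    fix p f0 and e :: real
    assume p: "p \<in> nu x ` J x" and f0: "f0 \<in> topspace (tau x)" and e: "0 < e"
    obtain j where j: "j \<in> J x" "p = nu x j" using p by blast
    have f0: "f0 \<in> cont_End (E x) (TE x)" using f0 topspace_tau[OF x] by simp
    let ?U = "{f \<in> cont_End (E x) (TE x). sup_seminorm (B l) (nu x j) (f - f0) < e}"
    have "openin (tau x) ?U"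
      unfolding tau S_topology_def using l j f0 e by (intro openin_seminorm_ball) auto
    moreover have "sup_seminorm (B l) (nu x j) (f0 - f0) = 0"
      using w seminorm_on_zero[OF nu_seminorm[OF x j(1)] E]
      by (simp add: sup_seminorm_def image_constant_conv)
    then have "f0 \<in> ?U" using f0 e by simp
    moreover have "p (f w - f0 w) < e" if "f \<in> ?U" for f
      using le[OF j(1) cvs.subspace_diff[OF L, of f f0]] that f0 j(2) by auto
    ultimately show "\<exists>U. openin (tau x) U \<and> f0 \<in> U \<and> (\<forall>f\<in>U. p (f w - f0 w) < e)" by blast
  qed
  then show ?thesis using nu_fundamental[OF x] by simp
qed

end

lemma U_space_cong:
  assumes "\<And>x. x \<in> X \<Longrightarrow> tau x = tau' x"
  shows "U_space TYPE('t) X E TE tau H TH D G TG \<longleftrightarrow> U_space TYPE('t) X E TE tau' H TH D G TG"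
  using assms unfolding U_space_def prod_sp_def by (simp cong: ball_cong)

theorem corollary2p3p29:
  fixes X :: "'x set"
    and Y :: "'y topology"
    and \<mu> :: "('y \<Rightarrow> complex) \<Rightarrow> complex"
    and E :: "'x \<Rightarrow> 'e::cvec set"
    and TE :: "'x \<Rightarrow> 'e topology"
    and J :: "'x \<Rightarrow> 'j set"
    and nu :: "'x \<Rightarrow> 'j \<Rightarrow> 'e \<Rightarrow> real"
    and tau :: "'x \<Rightarrow> ('e \<Rightarrow> 'e) topology"
    and H :: "('x \<Rightarrow> 'e) set"
    and TH :: "('x \<Rightarrow> 'e) topology"
    and A :: "('x \<Rightarrow> 'e \<Rightarrow> 'e) set"
    and L :: "'x \<Rightarrow> 'l set"
    and B :: "'x \<Rightarrow> 'l \<Rightarrow> 'e set"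
    and N :: "'x \<Rightarrow> 'e set"
    and D :: "('x \<Rightarrow> 'e) set"
    and G :: "(('x \<Rightarrow> 'e) \<Rightarrow> 'x \<Rightarrow> 'e) set"
    and TG :: "(('x \<Rightarrow> 'e) \<Rightarrow> 'x \<Rightarrow> 'e) topology"
  assumes data: "consistent_data X Y \<mu> E TE J nu tau H TH A"
    and B_bounded: "\<And>x l. x \<in> X \<Longrightarrow> l \<in> L x \<Longrightarrow> vn_bounded (E x) (TE x) (B x l)"
    and N_def: "\<And>x. N x = (\<Union>l\<in>L x. B x l)"
    and N_total: "\<And>x. x \<in> X \<Longrightarrow> total_in (E x) (TE x) (N x)"
    and D_subset: "D \<subseteq> H \<inter> prod_sp X N"
    and tau_S: "\<And>x. x \<in> X \<Longrightarrow> tau x = S_topology (E x) (TE x) (J x) (nu x) (L x) (B x)"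
    and G_def: "G = G_sp X E H A"
    and TG_def: "TG = G_top X E tau H A"
  shows "(\<forall>x\<in>X. \<forall>w \<in> (\<lambda>v. v x) ` D. continuous_map (tau x) (TE x) (\<lambda>f. f w)) \<and>
    (\<forall>F \<in> L1_sp Y \<mu> G TG. \<forall>x\<in>X. \<forall>v\<in>D.
       (\<lambda>s. Psi X E Y F x s (v x)) \<in> L1_sp Y \<mu> (E x) (TE x) \<and>
       weak_integral Y \<mu> (E x) (TE x) (\<lambda>s. Psi X E Y F x s (v x))
         = weak_integral Y \<mu> G TG F v x) \<and>
    U_space TYPE('t) X E TE (\<lambda>x. S_topology (E x) (TE x) (J x) (nu x) (L x) (B x)) H TH D G TG"
proof -
  interpret consistent_data X Y \<mu> E TE J nu tau H TH A by (rule data)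
  have eval: "continuous_map (tau x) (TE x) (\<lambda>f. f (v x))" if x: "x \<in> X" and v: "v \<in> D" for x v
  proof -
    \<comment> \<open>The value of \<open>v\<close> at \<open>x\<close> thus lies in one of the sets
      \<open>B x l\<close>, whose seminorms control evaluation there.\<close>
    have "v x \<in> N x" using D_subset x v by (auto simp: prod_sp_def)
    then obtain l where "l \<in> L x" "v x \<in> B x l" by (auto simp: N_def)
    then show ?thesis
      using continuous_map_evaluation[OF x tau_S[OF x]] B_bounded[OF x] by blast
  qed
  have "U_space TYPE('t) X E TE tau H TH D G TG"
    unfolding G_def TG_def using D_subset by (intro U_space_G) auto
  then have "U_space TYPE('t) X E TE (\<lambda>x. S_topology (E x) (TE x) (J x) (nu x) (L x) (B x)) H TH D G TG"
    using U_space_cong[of X tau, OF tau_S] by blast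
  moreover have "v \<in> H" if "v \<in> D" for v using D_subset that by blast
  ultimately show ?thesis
    using eval weak_integral_Psi_apply unfolding G_def TG_def by blast
qed

end
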